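(* Let $r\ge 3$ and $\sigma$ be integers with $0<\sigma<r-1$, and put $\rho=r-\sigma$, $m_1=2^\rho-1$. Let $G_r^\sigma$, $v_r^\sigma$, $W_r^\sigma$ and $H_\rho$ be as in the context. For $w\in W_r^\sigma$ let $F_w=\{i\in\{1,\dots,m_1\}: A_i(w)=A_i(v_r^\sigma)\}$ and let $d(w,v_r^\sigma)$ be the distance from $w$ to $v_r^\sigma$ in $H_\rho$. Then for every $w\in W_r^\sigma$, $$\log_2(1+|F_w|)+d(w,v_r^\sigma)=\rho.$$
   Context: Identify the nonzero vectors of $\mathbb{F}_2^r$ with the integers $1,\dots,2^r-1$ via binary representation. An $(r,\sigma)$-ordered pencil is a tuple $v=(A_0(v),A_1(v),\dots,A_{m_1}(v))$ where $S=A_0(v)\cup\{\mathbf 0\}$ is a $\sigma$-dimensional $\mathbb{F}_2$-linear subspace of $\mathbb{F}_2^r$ and $A_1(v),\dots,A_{m_1}(v)$ is an enumeration of the $m_1$ cosets of $S$ other than $S$. The graph $\mathcal{G}_r^\sigma$ has these ordered pencils as vertices, with $v=(A_0,\dots,A_{m_1})$ and $v'=(A'_0,\dots,A'_{m_1})$ adjacent iff: (1) $T=(A_0\cap A'_0)\cup\{\mathbf 0\}$ is a linear subspace of dimension $\sigma-1$; (2) for each $1\le i\le m_1$, $A_i\cap A'_i$ is a coset of $T$ different from $T$; (3) $\bigcup_{i=0}^{m_1}(A_i\cap A'_i)\cup\{\mathbf 0\}$ is a linear subspace of dimension $r-1$. Let $v_r^\sigma$ have $A_0=\{1,\dots,2^\sigma-1\}$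 and $A_i=\{i2^\sigma,\dots,(i+1)2^\sigma-1\}$ for $1\le i\le m_1$; $G_r^\sigma$ is the connected component of $\mathcal{G}_r^\sigma$ containing $v_r^\sigma$. Let $W_r^\sigma=\{w\in V(G_r^\sigma): A_0(w)=A_0(v_r^\sigma)\}$. The distance-2 graph $(G_r^\sigma)_2$ has vertex set $V(G_r^\sigma)$, two vertices adjacent iff they are at distance exactly 2 in $G_r^\sigma$; $H_\rho$ is the subgraph of $(G_r^\sigma)_2$ induced by $W_r^\sigma$. *)

theory Defs
  imports "HOL-Library.Z2" "HOL-Library.Function_Algebras" "HOL-Library.Extended_Real"
begin

section \<open>The vector space \<open>\<bbbF>\<^sub>2\<^sup>r\<close>\<close>

type_synonym vec2 = "nat \<Rightarrow> bit"

definition scale2 :: "bit \<Rightarrow> vec2 \<Rightarrow> vec2" where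
  "scale2 c x = (\<lambda>i. c * x i)"

interpretation F2: vector_space scale2
  by unfold_locales (auto simp: scale2_def fun_eq_iff algebra_simps)

text \<open>
  \<open>\<bbbF>\<^sub>2\<^sup>r\<close> is the subspace of the sequences supported on the first \<open>r\<close> positions.  In this way \<open>r\<close>
  remains an ordinary natural number, and subspaces and their dimensions are the library's.
\<close>

definition F2space :: "nat \<Rightarrow> vec2 set" where
  "F2space r = {x. \<forall>i\<ge>r. x i = 0}"

definition is_subspace_dim :: "nat \<Rightarrow> nat \<Rightarrow> vec2 set \<Rightarrow> bool" where
  "is_subspace_dim r d S \<longleftrightarrow> S \<subseteq> F2space r \<and> F2.subspace S \<and> F2.dim S = d"

definition cosets :: "nat \<Rightarrow> vec2 set \<Rightarrow> vec2 set set" where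
  "cosets r S = (\<lambda>x. (+) x ` S) ` F2space r"

text \<open>
  The identification of numbers with vectors: coordinate \<open>i\<close> is the binary digit of weight \<open>2\<^sup>i\<close>.
\<close>

definition vec_of_nat :: "nat \<Rightarrow> vec2" where
  "vec_of_nat n = (\<lambda>i. of_bool (bit n i))"


section \<open>Graphs\<close>

text \<open>
  Edges are ordered pairs; the adjacency relations below are symmetric and irreflexive.
\<close>

record 'a graph =
  verts :: "'a set"
  edges :: "('a \<times> 'a) set"

definition induced_subgraph :: "'a graph \<Rightarrow> 'a set \<Rightarrow> 'a graph" where
  "induced_subgraph G X = \<lparr>verts = verts G \<inter> X, edges = edges G \<inter> (X \<times> X)\<rparr>"

definition component :: "'a graph \<Rightarrow> 'a \<Rightarrow> 'a graph" where
  "component G v = induced_subgraph G {w. (v, w) \<in> (edges G)\<^sup>*}"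

text \<open>
  The length of a shortest walk; the infimum of the empty set makes it \<open>\<infinity>\<close> when there is none.
\<close>

definition graph_dist :: "'a graph \<Rightarrow> 'a \<Rightarrow> 'a \<Rightarrow> enat" where
  "graph_dist G u v = (INF n\<in>{n. (u, v) \<in> edges G ^^ n}. enat n)"

definition distance2_graph :: "'a graph \<Rightarrow> 'a graph" where
  "distance2_graph G = \<lparr>verts = verts G,
     edges = {(u, v). u \<in> verts G \<and> v \<in> verts G \<and> graph_dist G u v = 2}\<rparr>"


section \<open>Ordered pencils\<close>

type_synonym pencil = "vec2 set list"

definition m1 :: "nat \<Rightarrow> nat \<Rightarrow> nat" where
  "m1 r \<sigma> = 2 ^ (r - \<sigma>) - 1"

text \<open>
  The tuple \<open>(A\<^sub>0, \<dots>, A\<^bsub>m\<^sub>1\<^esub>)\<close> is a list \<open>v\<close> with \<open>A\<^sub>i = v ! i\<close>.  The entry \<open>A\<^sub>0\<close> is the subspace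
  without its zero vector.
\<close>

definition ordered_pencil :: "nat \<Rightarrow> nat \<Rightarrow> pencil \<Rightarrow> bool" where
  "ordered_pencil r \<sigma> v \<longleftrightarrow>
     length v = m1 r \<sigma> + 1 \<and>
     0 \<notin> v ! 0 \<and>
     (let S = v ! 0 \<union> {0} in
        is_subspace_dim r \<sigma> S \<and>
        bij_betw (\<lambda>i. v ! i) {1..m1 r \<sigma>} (cosets r S - {S}))"

definition pencil_adj :: "nat \<Rightarrow> nat \<Rightarrow> pencil \<Rightarrow> pencil \<Rightarrow> bool" where
  "pencil_adj r \<sigma> v v' \<longleftrightarrow>
     (let T = (v ! 0 \<inter> v' ! 0) \<union> {0} in
        is_subspace_dim r (\<sigma> - 1) T \<and>
        (\<forall>i\<in>{1..m1 r \<sigma>}. v ! i \<inter> v' ! i \<in> cosets r T - {T}) \<and>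
        is_subspace_dim r (r - 1) ((\<Union>i\<in>{0..m1 r \<sigma>}. v ! i \<inter> v' ! i) \<union> {0}))"

definition pencil_graph :: "nat \<Rightarrow> nat \<Rightarrow> pencil graph" where
  "pencil_graph r \<sigma> = \<lparr>verts = {v. ordered_pencil r \<sigma> v},
     edges = {(v, v'). ordered_pencil r \<sigma> v \<and> ordered_pencil r \<sigma> v' \<and> pencil_adj r \<sigma> v v'}\<rparr>"

definition base_pencil :: "nat \<Rightarrow> nat \<Rightarrow> pencil" where
  "base_pencil r \<sigma> =
     (vec_of_nat ` {1..2 ^ \<sigma> - 1}) #
     map (\<lambda>i. vec_of_nat ` {i * 2 ^ \<sigma>..(i + 1) * 2 ^ \<sigma> - 1}) [1..<m1 r \<sigma> + 1]"

definition G_graph :: "nat \<Rightarrow> nat \<Rightarrow> pencil graph" where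
  "G_graph r \<sigma> = component (pencil_graph r \<sigma>) (base_pencil r \<sigma>)"

definition W_set :: "nat \<Rightarrow> nat \<Rightarrow> pencil set" where
  "W_set r \<sigma> = {w \<in> verts (G_graph r \<sigma>). w ! 0 = base_pencil r \<sigma> ! 0}"

definition H_graph :: "nat \<Rightarrow> nat \<Rightarrow> pencil graph" where
  "H_graph r \<sigma> = induced_subgraph (distance2_graph (G_graph r \<sigma>)) (W_set r \<sigma>)"

definition F_set :: "nat \<Rightarrow> nat \<Rightarrow> pencil \<Rightarrow> nat set" where
  "F_set r \<sigma> w = {i \<in> {1..m1 r \<sigma>}. w ! i = base_pencil r \<sigma> ! i}"

end

(*
  On the component of the base pencil, an ordered pencil is the family of fibres of a surjective
  additive map p from F_2^r onto F_2^(r - sigma), and two pencils are adjacent iff their maps differ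
  by x |-> f(x) a with a nonzero vector a and a functional f that does not vanish on the kernel.
  Two maps with the same kernel at distance 2 therefore differ by a transvection.  Let E be the
  subspace on which p agrees with the base map p0; then |E| = (1 + |F|) 2^sigma.  A transvection at
  most doubles |E|.  If p x differs from p0 x, some transvection fixes p(E) and sends p x to p0 x,
  so it doubles |E|.  Hence the distance d from p to p0 satisfies |E| 2^d = 2^r.
*)
theory Submission
  imports Defs
begin

section \<open>Linear algebra over the two-element field\<close>

text \<open>An arbitrary ordered pencil lists its cosets in any order, so its labels need not be
  additive. Additivity spreads along edges: conditions (2) and (3) give a subspace that meets every
  coset and on which both label maps coincide. A single edge always moves the kernel, so members of
  \<open>W_set\<close> are never adjacent, and two rank-one changes \<open>(f, a)\<close> and
  \<open>(g, c)\<close> are needed. A vector of the old kernel moved by the first must be moved back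
  by the second, which forces \<open>c = a\<close>; the net change is \<open>(f + g, a)\<close>.
  Conversely, a change \<open>(f, a)\<close> with \<open>f\<close> zero on the kernel is split into
  \<open>(g, a)\<close> and \<open>(g + f, a)\<close>, where \<open>g\<close> is not zero on the
  kernel. The net change preserves the kernel only if \<open>f\<close> also vanishes at the vectors
  that \<open>p\<close> sends to \<open>a\<close>. This shapes the doubling step: \<open>f\<close>
  must be 0 on \<open>E\<close> and at some \<open>y\<close> with \<open>p y = a\<close>, yet 1 at
  \<open>x\<close>. Dimensions are replaced by cardinalities, so that rank-nullity and index two
  become counting.\<close>

lemma vec2_add_self [simp]: "(x :: vec2) + x = 0"
  by (simp add: fun_eq_iff)

lemma vec2_double [simp]: "2 * (x :: vec2) = 0"
  by (simp add: mult_2)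

lemma vec2_add_self_left [simp]: "(x :: vec2) + (x + y) = y"
  by (simp add: add.assoc[symmetric])

lemma vec2_add_eq_0_iff [simp]: "(x :: vec2) + y = 0 \<longleftrightarrow> x = y"
  by (metis add.right_neutral vec2_add_self vec2_add_self_left)

text \<open>The only scalars are 0 and 1, so closure under scaling comes for free.\<close>

lemma subspace_iff: "F2.subspace S \<longleftrightarrow> 0 \<in> S \<and> (\<forall>x\<in>S. \<forall>y\<in>S. x + y \<in> S)"
proof -
  have "scale2 c x = 0 \<or> scale2 c x = x" for c x
    by (cases c) (auto simp: scale2_def fun_eq_iff)
  then show ?thesis
    unfolding F2.subspace_def by metis
qed

lemma subspace_F2space: "F2.subspace (F2space r)"
  by (auto simp: subspace_iff F2space_def)

lemma subspace_cancel_left: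
  assumes "F2.subspace S" "x \<in> S" shows "x + y \<in> S \<longleftrightarrow> y \<in> S"
  using assms vec2_add_self_left[of x y] unfolding subspace_iff by metis

lemma subspace_cancel_right:
  assumes "F2.subspace S" "x \<in> S" shows "y + x \<in> S \<longleftrightarrow> y \<in> S"
  using subspace_cancel_left[OF assms, of y] by (simp add: add.commute[of y])

section \<open>Numbers below a power of two as vectors\<close>

lemma vec_of_nat_0 [simp]: "vec_of_nat 0 = 0"
  by (simp add: vec_of_nat_def fun_eq_iff)

lemma inj_vec_of_nat: "inj vec_of_nat"
proof (rule injI)
  fix m n assume "vec_of_nat m = vec_of_nat n"
  then have "of_bool (bit m i) = (of_bool (bit n i) :: bit)" for i
    by (simp add: vec_of_nat_def fun_eq_iff)
  then have "bit m i = bit n i" for i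
    by (metis of_bool_eq_iff)
  then show "m = n" by (auto intro!: bit_eqI)
qed

text \<open>Induction peels off the lowest digit: if \<open>m\<close> represents the shifted vector,
  then \<open>2 * m\<close>, plus 1 if \<open>x 0 = 1\<close>, represents \<open>x\<close>.\<close>

lemma F2space_vec_of_nat: "x \<in> F2space n \<Longrightarrow> \<exists>m<2^n. vec_of_nat m = x"
proof (induction n arbitrary: x)
  case 0
  then show ?case by (auto simp: F2space_def fun_eq_iff)
next
  case (Suc n)
  have "(\<lambda>i. x (Suc i)) \<in> F2space n" using Suc.prems by (auto simp: F2space_def)
  from Suc.IH[OF this] obtain m where m: "m < 2^n" "vec_of_nat m = (\<lambda>i. x (Suc i))" by blast
  let ?k = "of_bool (x 0 = 1) + 2 * m"
  have "vec_of_nat ?k i = x i" for i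
  proof (cases i)
    case 0
    then show ?thesis by (cases "x 0") (auto simp: vec_of_nat_def bit_0)
  next
    case (Suc j)
    then show ?thesis using fun_cong[OF m(2), of j]
      by (simp add: vec_of_nat_def bit_Suc)
  qed
  moreover have "?k < 2 ^ Suc n" using m(1) by (auto simp: of_bool_def)
  ultimately show ?case by (auto simp: fun_eq_iff)
qed

lemma vec_of_nat_in_F2space: "m < 2^n \<Longrightarrow> vec_of_nat m \<in> F2space n"
  by (auto simp: vec_of_nat_def F2space_def)
     (metis bit_take_bit_iff leD take_bit_nat_eq_self_iff)

lemma bij_betw_vec_of_nat: "bij_betw vec_of_nat {..<2^n} (F2space n)"
proof -
  have "vec_of_nat ` {..<2^n} = F2space n"
    using vec_of_nat_in_F2space by (auto dest!: F2space_vec_of_nat)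
  then show ?thesis
    using inj_on_subset[OF inj_vec_of_nat] by (simp add: bij_betw_def)
qed

section \<open>Dimension expressed by cardinality\<close>

lemma finite_F2space [simp]: "finite (F2space n)"
  using bij_betw_finite[OF bij_betw_vec_of_nat] by auto

lemma card_F2space: "card (F2space n) = 2^n"
  using bij_betw_same_card[OF bij_betw_vec_of_nat] by simp

text \<open>An independent vector \<open>b\<close> adjoins to the span a disjoint translate of it,
  which doubles the cardinality.\<close>

lemma card_span:
  assumes "finite B" "F2.independent B"
  shows "finite (F2.span B) \<and> card (F2.span B) = 2 ^ card B"
  using assms
proof (induction B rule: finite_induct)
  case empty
  then show ?case by simp
next
  case (insert b B)
  then have ind: "F2.independent B" and nb: "b \<notin> F2.span B"
    by (auto simp: F2.independent_insert)
  let ?S = "F2.span B"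
  have S: "F2.subspace ?S" by simp
  have "F2.span (insert b B) = ?S \<union> (+) b ` ?S"
  proof (intro set_eqI)
    fix x
    have "(\<exists>k. x - scale2 k b \<in> ?S) \<longleftrightarrow> x - scale2 0 b \<in> ?S \<or> x - scale2 1 b \<in> ?S"
      by (metis bit.exhaust)
    then have "x \<in> F2.span (insert b B) \<longleftrightarrow> x \<in> ?S \<or> x - b \<in> ?S"
      by (simp add: F2.span_insert)
    then show "x \<in> F2.span (insert b B) \<longleftrightarrow> x \<in> ?S \<union> (+) b ` ?S"
      by (auto simp: image_iff intro!: bexI[of _ "x - b"])
  qed
  moreover have "?S \<inter> (+) b ` ?S = {}"
    using nb subspace_cancel_right[OF S] by auto
  moreover have "card ((+) b ` ?S) = card ?S" by (rule card_image) simp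
  ultimately show ?case using insert ind by (simp add: card_Un_disjoint)
qed

lemma is_subspace_dim_iff_card:
  "is_subspace_dim r d S \<longleftrightarrow> S \<subseteq> F2space r \<and> F2.subspace S \<and> card S = 2 ^ d"
proof -
  have "card S = 2 ^ F2.dim S" if "S \<subseteq> F2space r" "F2.subspace S"
  proof -
    obtain B where B: "B \<subseteq> S" "F2.independent B" "S \<subseteq> F2.span B" "card B = F2.dim S"
      using F2.basis_exists by blast
    have "finite B" using B(1) that(1) by (meson finite_F2space finite_subset)
    moreover have "F2.span B = S" using B(1,3) that(2) by (simp add: F2.span_minimal subset_antisym)
    ultimately show ?thesis using card_span[of B] B by simp
  qed
  then show ?thesis by (auto simp: is_subspace_dim_def)
qed

text \<open>In characteristic 2 the difference of two vectors is their sum, so no signs occur in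
  coset computations.\<close>

lemma mem_coset_iff: "z \<in> (+) (u :: vec2) ` S \<longleftrightarrow> u + z \<in> S"
  by (auto simp: image_iff intro!: bexI[of _ "u + z"])

lemma coset_eq:
  assumes "F2.subspace S" "x \<in> (+) y ` S" shows "(+) y ` S = (+) x ` S"
proof -
  have "x + y \<in> S" using assms(2) by (auto simp: add.commute[of _ y])
  moreover have "y + z = (x + y) + (x + z)" for z
    by (metis add.assoc add.left_commute vec2_add_self_left)
  ultimately show ?thesis using subspace_cancel_left[OF assms(1), of "x + y"]
    by (intro set_eqI) (metis mem_coset_iff)
qed

lemma half_power: "2 * c = 2 ^ n \<Longrightarrow> 0 < n \<Longrightarrow> c = (2::nat) ^ (n - 1)"
  by (cases n) auto

section \<open>Additive maps on subspaces, their fibres and kernels\<close>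

definition additive_on :: "'a::ab_group_add set \<Rightarrow> ('a \<Rightarrow> 'b::ab_group_add) \<Rightarrow> bool" where
  "additive_on X f \<longleftrightarrow> (\<forall>x\<in>X. \<forall>y\<in>X. f (x + y) = f x + f y)"

lemma additive_onD: "additive_on X f \<Longrightarrow> x \<in> X \<Longrightarrow> y \<in> X \<Longrightarrow> f (x + y) = f x + f y"
  by (simp add: additive_on_def)

lemma additive_on_subset: "additive_on X f \<Longrightarrow> Y \<subseteq> X \<Longrightarrow> additive_on Y f"
  by (auto simp: additive_on_def)

lemma additive_on_add:
  "additive_on X f \<Longrightarrow> additive_on X g \<Longrightarrow> additive_on X (\<lambda>x. f x + g x)"
  by (simp add: additive_on_def add_ac)

lemma additive_on_0: "additive_on X f \<Longrightarrow> 0 \<in> X \<Longrightarrow> f 0 = 0"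
  using additive_onD[of X f 0 0] by simp

lemma subspace_agree:
  assumes "F2.subspace X" "additive_on X f" "additive_on X g"
  shows "F2.subspace {x\<in>X. f x = g x}"
  using assms additive_on_0[of X f] additive_on_0[of X g]
  by (auto simp: subspace_iff additive_on_def)

lemma subspace_kernel:
  assumes "F2.subspace X" "additive_on X f" shows "F2.subspace {x\<in>X. f x = 0}"
  using subspace_agree[OF assms, of "\<lambda>_. 0"] by (simp add: additive_on_def)

lemma fibre_eq_coset:
  assumes X: "F2.subspace X" and f: "additive_on X f" and x: "x \<in> X"
  shows "{y\<in>X. f y = f x} = (+) x ` {y\<in>X. f y = 0}"
proof (intro set_eqI iffI)
  fix y assume y: "y \<in> {y\<in>X. f y = f x}"
  then have "x + y \<in> X" using X x subspace_iff by blast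
  moreover have "f y = f x + f (x + y)" using additive_onD[OF f x \<open>x + y \<in> X\<close>] by simp
  ultimately show "y \<in> (+) x ` {y\<in>X. f y = 0}" using y
    by (intro image_eqI[of _ _ "x + y"]) auto
next
  fix y assume "y \<in> (+) x ` {y\<in>X. f y = 0}"
  then show "y \<in> {y\<in>X. f y = f x}"
    using x f X by (auto simp: additive_on_def subspace_iff)
qed

text \<open>Rank-nullity in counting form: all fibres over the image are translates of the
  kernel.\<close>

lemma card_image_times_kernel:
  assumes X: "F2.subspace X" and f: "additive_on X f" and fin: "finite X"
  shows "card X = card (f ` X) * card {x\<in>X. f x = 0}"
proof -
  have "card X = (\<Sum>y\<in>f ` X. card {x\<in>X. f x = y})"
    using sum.image_gen[OF fin, of "\<lambda>_. 1::nat" f] by simp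
  also have "\<dots> = (\<Sum>y\<in>f ` X. card {x\<in>X. f x = 0})"
    using fibre_eq_coset[OF X f] by (intro sum.cong) (auto simp: card_image)
  finally show ?thesis by simp
qed

lemma card_eq_twice_kernel:
  fixes f :: "vec2 \<Rightarrow> bit"
  assumes "F2.subspace X" "additive_on X f" "finite X" "s \<in> X" "f s = 1"
  shows "card X = 2 * card {x\<in>X. f x = 0}"
proof -
  have "f 0 = 0" "0 \<in> X" using assms additive_on_0 subspace_iff by auto
  have "b \<in> f ` X" for b
    using \<open>f 0 = 0\<close> \<open>0 \<in> X\<close> assms(4,5) by (cases b) (auto simp: image_iff intro: bexI[of _ 0] bexI[of _ s])
  then have "f ` X = {0, 1}" by (auto intro: bit.exhaust)
  then show ?thesis using card_image_times_kernel[OF assms(1-3)] by simp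
qed

text \<open>Covers functionals that may vanish identically; it is the source of the bound that one
  step in \<open>H_graph\<close> at most doubles the agreement.\<close>

lemma card_le_twice_kernel:
  fixes f :: "vec2 \<Rightarrow> bit"
  assumes "F2.subspace X" "additive_on X f" "finite X"
  shows "card X \<le> 2 * card {x\<in>X. f x = 0}"
proof (cases "\<exists>s\<in>X. f s = 1")
  case True
  then show ?thesis using card_eq_twice_kernel[OF assms] by fastforce
next
  case False
  then have "{x\<in>X. f x = 0} = X" by auto
  then show ?thesis by simp
qed

lemma subspace_Un_translate:
  assumes "F2.subspace K" shows "F2.subspace (K \<union> (+) y ` K)"
proof -
  have "(y + a) + (y + b) = a + b" "(y + a) + b = y + (a + b)" "a + (y + b) = y + (a + b)"
    for a b :: vec2
    by (metis add.assoc add.left_commute vec2_add_self_left)+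
  then show ?thesis using assms unfolding subspace_iff by (simp add: ball_Un)
qed

text \<open>A subspace \<open>M\<close> that is maximal among those containing \<open>K\<close> and
  avoiding \<open>x\<close> has index 2, and the indicator of its complement is the
  functional.\<close>

lemma separating_functional:
  assumes K: "F2.subspace K" "K \<subseteq> F2space r" and x: "x \<in> F2space r" "x \<notin> K"
  obtains f :: "vec2 \<Rightarrow> bit"
  where "additive_on (F2space r) f" "\<forall>k\<in>K. f k = 0" "f x = 1"
proof -
  define A where "A = {L. F2.subspace L \<and> K \<subseteq> L \<and> L \<subseteq> F2space r \<and> x \<notin> L}"
  have "finite A" by (rule finite_subset[of _ "Pow (F2space r)"]) (auto simp: A_def)
  moreover have "K \<in> A" using assms by (simp add: A_def)
  ultimately obtain M where "M \<in> A" and max: "\<And>L. L \<in> A \<Longrightarrow> M \<subseteq> L \<Longrightarrow> L = M"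
    using finite_has_maximal[of A] by (metis empty_iff)
  then have M: "F2.subspace M" "K \<subseteq> M" "M \<subseteq> F2space r" "x \<notin> M"
    by (simp_all add: A_def)
  note Ms = M(1)
  have V: "F2.subspace (F2space r)" by (rule subspace_F2space)
  \<comment> \<open>By maximality, adjoining \<open>y\<close> to \<open>M\<close> must capture
    \<open>x\<close>. So the complement of \<open>M\<close> is the single coset of \<open>x\<close>,
    and a sum of two vectors outside \<open>M\<close> falls into \<open>M\<close>.\<close>
  have xy: "x + y \<in> M" if y: "y \<in> F2space r" "y \<notin> M" for y
  proof (rule ccontr)
    assume n: "x + y \<notin> M"
    let ?L = "M \<union> (+) y ` M"
    have "x \<notin> (+) y ` M" using n by (auto simp: add.commute[of _ y])
    then have "x \<notin> ?L" using M by simp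
    moreover have "?L \<subseteq> F2space r" using M(3) y(1) V by (auto simp: subspace_iff)
    ultimately have "?L \<in> A"
      using subspace_Un_translate[OF Ms] M(2) unfolding A_def by blast
    then have "?L = M" using max[of ?L] by blast
    moreover have "y + 0 \<in> ?L" using Ms unfolding subspace_iff by blast
    ultimately show False using y by simp
  qed
  define f :: "vec2 \<Rightarrow> bit" where "f y = of_bool (y \<notin> M)" for y
  have "f (y + z) = f y + f z" if "y \<in> F2space r" "z \<in> F2space r" for y z
  proof (cases "y \<in> M \<or> z \<in> M")
    case True
    then show ?thesis using subspace_cancel_left[OF Ms] subspace_cancel_right[OF Ms]
      by (auto simp: f_def)
  next
    case False
    then have "(x + y) + (x + z) \<in> M"
      using F2.subspace_add[OF Ms xy[OF that(1)] xy[OF that(2)]] by blast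
    moreover have "(x + y) + (x + z) = y + z"
      by (metis add.assoc add.left_commute vec2_add_self_left)
    ultimately show ?thesis using False by (simp add: f_def)
  qed
  then have "additive_on (F2space r) f" by (simp add: additive_on_def)
  moreover have "f k = 0" if "k \<in> K" for k using M that by (auto simp: f_def)
  moreover have "f x = 1" using M by (auto simp: f_def)
  ultimately show thesis using that by blast
qed


section \<open>Distances in graphs\<close>

lemma graph_dist_le: "(u, v) \<in> edges G ^^ n \<Longrightarrow> graph_dist G u v \<le> enat n"
  unfolding graph_dist_def by (rule INF_lower) simp

text \<open>A finite distance excludes the empty infimum, and a nonempty set of extended naturals
  contains its infimum.\<close>

lemma graph_dist_attained:
  assumes "graph_dist G u v = enat n" shows "(u, v) \<in> edges G ^^ n"
proof -
  let ?A = "enat ` {n. (u, v) \<in> edges G ^^ n}"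
  have "?A \<noteq> {}"
  proof
    assume "?A = {}"
    then have "graph_dist G u v = top" unfolding graph_dist_def by (simp only: Inf_empty)
    then show False using assms by (simp add: top_enat_def)
  qed
  then obtain k where "k \<in> ?A" by blast
  then have "Inf ?A \<in> ?A" by (rule wellorder_InfI)
  then show ?thesis using assms unfolding graph_dist_def by (simp add: image_iff)
qed

lemma graph_dist_eqI:
  assumes "(u, v) \<in> edges G ^^ n" "\<And>m. (u, v) \<in> edges G ^^ m \<Longrightarrow> n \<le> m"
  shows "graph_dist G u v = enat n"
proof (rule antisym)
  show "graph_dist G u v \<le> enat n" using assms(1) by (rule graph_dist_le)
  show "enat n \<le> graph_dist G u v"
    unfolding graph_dist_def by (rule INF_greatest) (simp add: assms(2))
qed


section \<open>Pencils as surjective additive maps\<close>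

text \<open>Putting zero back into entry 0 makes all entries full cosets, so that index 0 can be
  treated like the others.\<close>

definition block :: "pencil \<Rightarrow> nat \<Rightarrow> vec2 set" where
  "block v i = (if i = 0 then insert 0 (v ! 0) else v ! i)"

locale pencil_space =
  fixes r \<sigma> :: nat
  assumes sigma_pos: "0 < \<sigma>" and sigma_less: "\<sigma> < r"
begin

abbreviation V :: "vec2 set" where "V \<equiv> F2space r"
abbreviation Q :: "vec2 set" where "Q \<equiv> F2space (r - \<sigma>)"

lemma V_closed [simp]: "0 \<in> V" "x \<in> V \<Longrightarrow> y \<in> V \<Longrightarrow> x + y \<in> V"
  using subspace_F2space[of r] by (auto simp: subspace_iff)

lemma indices_eq: "{..<2 ^ (r - \<sigma>)} = {1..m1 r \<sigma>} \<union> {0}"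
proof -
  have "{..<2 ^ (r - \<sigma>)} = {..<Suc (m1 r \<sigma>)}" by (simp add: m1_def)
  also have "\<dots> = {1..m1 r \<sigma>} \<union> {0}" by auto
  finally show ?thesis .
qed

lemma ordered_pencil_iff_block:
  "ordered_pencil r \<sigma> v \<longleftrightarrow>
     length v = 2 ^ (r - \<sigma>) \<and> 0 \<notin> v ! 0 \<and> is_subspace_dim r \<sigma> (block v 0) \<and>
     bij_betw (block v) {..<2 ^ (r - \<sigma>)} (cosets r (block v 0))"
proof -
  have S: "v ! 0 \<union> {0} = block v 0" by (auto simp: block_def)
  have "block v 0 = (+) 0 ` block v 0" by simp
  then have mem: "block v 0 \<in> cosets r (block v 0)"
    unfolding cosets_def using V_closed(1) by (rule image_eqI)
  \<comment> \<open>Index 0 and the coset \<open>block v 0\<close> are new on their respective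
    sides, so adjoining this pair neither creates nor destroys bijectivity.\<close>
  have "bij_betw (block v) {..<2 ^ (r - \<sigma>)} (cosets r (block v 0)) \<longleftrightarrow>
      bij_betw (block v) {1..m1 r \<sigma>} (cosets r (block v 0) - {block v 0})"
    using notIn_Un_bij_betw3[of 0 "{1..m1 r \<sigma>}" "block v" "cosets r (block v 0) - {block v 0}"]
    unfolding indices_eq by (simp add: insert_absorb[OF mem])
  also have "\<dots> \<longleftrightarrow> bij_betw (\<lambda>i. v ! i) {1..m1 r \<sigma>} (cosets r (block v 0) - {block v 0})"
    by (rule bij_betw_cong) (auto simp: block_def)
  finally show ?thesis unfolding ordered_pencil_def Let_def S by (simp add: m1_def)
qed

lemma pencil_adj_iff_block:
  "pencil_adj r \<sigma> v v' \<longleftrightarrow>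
     is_subspace_dim r (\<sigma> - 1) (block v 0 \<inter> block v' 0) \<and>
     (\<forall>i\<in>{1..m1 r \<sigma>}. block v i \<inter> block v' i \<in>
        cosets r (block v 0 \<inter> block v' 0) - {block v 0 \<inter> block v' 0}) \<and>
     is_subspace_dim r (r - 1) (\<Union>i<2 ^ (r - \<sigma>). block v i \<inter> block v' i)"
proof -
  have T: "v ! 0 \<inter> v' ! 0 \<union> {0} = block v 0 \<inter> block v' 0" by (auto simp: block_def)
  have U: "(\<Union>i\<in>{0..m1 r \<sigma>}. v ! i \<inter> v' ! i) \<union> {0} = (\<Union>i\<in>{1..m1 r \<sigma>} \<union> {0}. block v i \<inter> block v' i)"
  proof -
    have "{0..m1 r \<sigma>} = {1..m1 r \<sigma>} \<union> {0}" by auto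
    then show ?thesis by (auto simp: block_def)
  qed
  have "v ! i \<inter> v' ! i = block v i \<inter> block v' i" if "i \<in> {1..m1 r \<sigma>}" for i
    using that by (simp add: block_def)
  then show ?thesis unfolding pencil_adj_def Let_def T U indices_eq
    by (simp only: cong: ball_cong)
qed

text \<open>Only values on \<open>V\<close> matter. Two maps that agree there give the same pencil,
  so a labelling is determined by its pencil on \<open>V\<close> alone.\<close>

definition labelling :: "(vec2 \<Rightarrow> vec2) \<Rightarrow> bool" where
  "labelling p \<longleftrightarrow> additive_on V p \<and> p ` V = Q"

definition pencil_of :: "(vec2 \<Rightarrow> vec2) \<Rightarrow> pencil" where
  "pencil_of p = map (\<lambda>i. {x\<in>V. p x = vec_of_nat i} - (if i = 0 then {0} else {})) [0..<2 ^ (r - \<sigma>)]"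

lemma length_pencil_of [simp]: "length (pencil_of p) = 2 ^ (r - \<sigma>)"
  by (simp add: pencil_of_def)

lemma nth_pencil_of:
  "i < 2 ^ (r - \<sigma>) \<Longrightarrow>
    pencil_of p ! i = {x\<in>V. p x = vec_of_nat i} - (if i = 0 then {0} else {})"
  by (simp add: pencil_of_def)

lemma block_pencil_of:
  assumes "additive_on V p" "i < 2 ^ (r - \<sigma>)"
  shows "block (pencil_of p) i = {x\<in>V. p x = vec_of_nat i}"
  using assms additive_on_0[of V p] by (auto simp: block_def nth_pencil_of)

lemma eq_pencil_ofI:
  assumes "length v = 2 ^ (r - \<sigma>)" "0 \<notin> v ! 0"
    and "\<And>i. i < 2 ^ (r - \<sigma>) \<Longrightarrow> block v i = {x\<in>V. p x = vec_of_nat i}"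
  shows "v = pencil_of p"
proof (rule nth_equalityI)
  fix i assume "i < length v"
  then have i: "i < 2 ^ (r - \<sigma>)" using assms by simp
  have "v ! i = block v i - (if i = 0 then {0} else {})" using assms(2) by (auto simp: block_def)
  then show "v ! i = pencil_of p ! i" using assms(3)[OF i] nth_pencil_of[OF i] by simp
qed (simp add: assms)

lemma labellingD:
  assumes "labelling p"
  shows "additive_on V p" "p ` V = Q" "\<And>x. x \<in> V \<Longrightarrow> p x \<in> Q" "p 0 = 0"
    "\<And>x y. x \<in> V \<Longrightarrow> y \<in> V \<Longrightarrow> p (x + y) = p x + p y"
  using assms additive_on_0[of V p] by (auto simp: labelling_def additive_on_def)

lemma labelling_surj:
  assumes "labelling p" "y \<in> Q" obtains x where "x \<in> V" "p x = y"
proof -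
  have "y \<in> p ` V" using assms labellingD(2) by simp
  then show thesis using that by auto
qed

lemma card_kernel:
  assumes "labelling p" shows "card {x\<in>V. p x = 0} = 2 ^ \<sigma>"
proof -
  have "2 ^ r = 2 ^ (r - \<sigma>) * card {x\<in>V. p x = 0}"
    using card_image_times_kernel[OF subspace_F2space labellingD(1)[OF assms] finite_F2space]
    by (simp add: labellingD(2)[OF assms] card_F2space)
  moreover have "(2::nat) ^ r = 2 ^ (r - \<sigma>) * 2 ^ \<sigma>"
    using sigma_less by (simp flip: power_add)
  ultimately show ?thesis by simp
qed

lemma ordered_pencil_of:
  assumes p: "labelling p" shows "ordered_pencil r \<sigma> (pencil_of p)"
proof -
  note add = labellingD(1)[OF p]
  let ?S = "{x\<in>V. p x = 0}"
  have S: "block (pencil_of p) 0 = ?S" using block_pencil_of[OF add, of 0] by simp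
  have ne: "\<exists>x\<in>V. p x = vec_of_nat i" if "i < 2 ^ (r - \<sigma>)" for i
    using vec_of_nat_in_F2space[OF that] labellingD(2)[OF p] by (metis image_iff)
  have "is_subspace_dim r \<sigma> ?S"
    using subspace_kernel[OF subspace_F2space add] card_kernel[OF p]
    by (auto simp: is_subspace_dim_iff_card)
  moreover have "inj_on (block (pencil_of p)) {..<2 ^ (r - \<sigma>)}"
  proof (rule inj_onI)
    fix i j :: nat assume ij: "i \<in> {..<2 ^ (r - \<sigma>)}" "j \<in> {..<2 ^ (r - \<sigma>)}"
      "block (pencil_of p) i = block (pencil_of p) j"
    then obtain x where "x \<in> V" "p x = vec_of_nat i" using ne by blast
    then have "x \<in> block (pencil_of p) i" using ij(1) block_pencil_of[OF add, of i] by simp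
    then have "x \<in> block (pencil_of p) j" using ij(3) by simp
    then have "vec_of_nat i = vec_of_nat j"
      using ij(2) \<open>p x = vec_of_nat i\<close> block_pencil_of[OF add, of j] by simp
    then show "i = j" using inj_vec_of_nat by (simp add: inj_def)
  qed
  moreover have "block (pencil_of p) ` {..<2 ^ (r - \<sigma>)} = cosets r ?S"
  proof -
    have "block (pencil_of p) ` {..<2 ^ (r - \<sigma>)} = (\<lambda>y. {x\<in>V. p x = y}) ` vec_of_nat ` {..<2 ^ (r - \<sigma>)}"
      unfolding image_image by (rule image_cong) (auto simp: block_pencil_of[OF add])
    also have "\<dots> = (\<lambda>y. {x\<in>V. p x = y}) ` p ` V"
      using bij_betw_vec_of_nat[of "r - \<sigma>"] by (simp add: labellingD(2)[OF p] bij_betw_def)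
    also have "\<dots> = cosets r ?S"
      unfolding image_image cosets_def
      by (rule image_cong) (simp_all add: fibre_eq_coset[OF subspace_F2space add])
    finally show ?thesis .
  qed
  ultimately show ?thesis
    unfolding ordered_pencil_iff_block S by (simp add: bij_betw_def nth_pencil_of)
qed

text \<open>Each vector is labelled with the binary vector of the index of its block. The order of
  the cosets is arbitrary, so additivity is not claimed; the last clause says only that equal labels
  mean equal cosets.\<close>

lemma ordered_pencil_labels:
  assumes v: "ordered_pencil r \<sigma> v"
  obtains p where "p ` V = Q" "v = pencil_of p"
    "\<And>i. i < 2 ^ (r - \<sigma>) \<Longrightarrow> block v i = {x\<in>V. p x = vec_of_nat i}"
    "\<And>x y. x \<in> V \<Longrightarrow> y \<in> V \<Longrightarrow> p x = p y \<longleftrightarrow> x + y \<in> block v 0"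
proof -
  let ?S = "block v 0" and ?I = "{..<2 ^ (r - \<sigma>)}"
  have S: "F2.subspace ?S" "?S \<subseteq> V" and inj: "inj_on (block v) ?I"
    and im: "block v ` ?I = cosets r ?S"
    using v by (auto simp: ordered_pencil_iff_block is_subspace_dim_iff_card bij_betw_def)
  have coset: "block v i = (+) x ` ?S" if "i \<in> ?I" "x \<in> block v i" for i x
  proof -
    have "block v i \<in> cosets r ?S" using that im by blast
    then obtain y where "block v i = (+) y ` ?S" by (auto simp: cosets_def)
    then show ?thesis using coset_eq[OF S(1)] that(2) by simp
  qed
  have "\<exists>i\<in>?I. x \<in> block v i" if "x \<in> V" for x
  proof -
    have "(+) x ` ?S \<in> block v ` ?I" using that im by (simp add: cosets_def)
    moreover have "x \<in> (+) x ` ?S" using S(1) by (simp add: mem_coset_iff subspace_iff)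
    ultimately show ?thesis by (metis imageE)
  qed
  then obtain g where g: "\<And>x. x \<in> V \<Longrightarrow> g x \<in> ?I \<and> x \<in> block v (g x)" by metis
  have sub: "block v i \<subseteq> V" if i: "i \<in> ?I" for i
  proof -
    have "block v i \<in> cosets r ?S" using i im by blast
    then show ?thesis using S(2) by (auto simp: cosets_def subset_iff)
  qed
  have g_unique: "g x = i" if "i \<in> ?I" "x \<in> block v i" for i x
  proof -
    have "x \<in> V" using sub that by blast
    then have "block v (g x) = block v i" using coset that g by blast
    then show ?thesis using inj g[OF \<open>x \<in> V\<close>] that(1) by (auto dest: inj_onD)
  qed
  define p where "p x = vec_of_nat (g x)" for x
  have blk: "block v i = {x\<in>V. p x = vec_of_nat i}" if "i < 2 ^ (r - \<sigma>)" for i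
    using that sub[of i] g_unique[of i] g inj_vec_of_nat by (auto simp: p_def dest: injD)
  have eq: "p x = p y \<longleftrightarrow> x + y \<in> ?S" if "x \<in> V" "y \<in> V" for x y
  proof -
    have "p x = p y \<longleftrightarrow> y \<in> block v (g x)"
      using g[OF that(1)] that(2) by (auto simp: p_def blk)
    also have "\<dots> \<longleftrightarrow> x + y \<in> ?S" using coset[of "g x" x] g[OF that(1)] by (simp add: mem_coset_iff)
    finally show ?thesis .
  qed
  have "p ` V = Q"
  proof
    show "p ` V \<subseteq> Q" using g vec_of_nat_in_F2space by (auto simp: p_def)
  next
    show "Q \<subseteq> p ` V"
    proof
      fix y assume "y \<in> Q"
      then obtain i where i: "i < 2 ^ (r - \<sigma>)" "vec_of_nat i = y" using F2space_vec_of_nat by blast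
      then have "block v i \<in> cosets r ?S" using im by blast
      then have "block v i \<noteq> {}" using S(1) by (auto simp: cosets_def subspace_iff)
      then obtain x where "x \<in> block v i" by blast
      then show "y \<in> p ` V" using blk[OF i(1)] i(2) by (intro image_eqI[of _ _ x]) auto
    qed
  qed
  moreover have "v = pencil_of p"
    using v blk by (intro eq_pencil_ofI) (auto simp: ordered_pencil_iff_block)
  ultimately show thesis using that blk eq by blast
qed

text \<open>Turns the union in adjacency condition (3) into the set where two label maps
  coincide.\<close>

lemma union_agree:
  assumes "p ` V \<subseteq> Q"
    and "\<And>i. i < 2 ^ (r - \<sigma>) \<Longrightarrow> block v i = {x\<in>V. p x = vec_of_nat i}"
    and "\<And>i. i < 2 ^ (r - \<sigma>) \<Longrightarrow> block v' i = {x\<in>V. q x = vec_of_nat i}"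
  shows "(\<Union>i<2 ^ (r - \<sigma>). block v i \<inter> block v' i) = {x\<in>V. p x = q x}"
proof (intro set_eqI iffI)
  fix x assume x: "x \<in> {x\<in>V. p x = q x}"
  then obtain i where i: "i < 2 ^ (r - \<sigma>)" "vec_of_nat i = p x"
    using assms(1) F2space_vec_of_nat by blast
  then have "x \<in> block v i \<inter> block v' i" using x assms(2,3) by simp
  then show "x \<in> (\<Union>i<2 ^ (r - \<sigma>). block v i \<inter> block v' i)" using i(1) by blast
qed (use assms(2,3) in auto)

text \<open>Sums can be computed at representatives in the agreement set \<open>?U\<close>, where
  the labels of \<open>v\<close> are those of the additive map \<open>p\<close>.\<close>

lemma adjacent_labelling:
  assumes p: "labelling p" and v: "ordered_pencil r \<sigma> v" and adj: "pencil_adj r \<sigma> (pencil_of p) v"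
  obtains q where "labelling q" "v = pencil_of q"
proof -
  from v obtain q where q: "q ` V = Q" "v = pencil_of q"
    "\<And>i. i < 2 ^ (r - \<sigma>) \<Longrightarrow> block v i = {x\<in>V. q x = vec_of_nat i}"
    "\<And>x y. x \<in> V \<Longrightarrow> y \<in> V \<Longrightarrow> q x = q y \<longleftrightarrow> x + y \<in> block v 0"
    by (rule ordered_pencil_labels) blast
  have S: "F2.subspace (block v 0)"
    using v by (auto simp: ordered_pencil_iff_block is_subspace_dim_iff_card)
  let ?U = "{x\<in>V. p x = q x}"
  have Ueq: "(\<Union>i<2 ^ (r - \<sigma>). block (pencil_of p) i \<inter> block v i) = ?U"
    using labellingD[OF p] q(3) by (intro union_agree) (auto simp: block_pencil_of)
  have U: "F2.subspace ?U"
    using adj unfolding pencil_adj_iff_block Ueq is_subspace_dim_iff_card by blast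
  \<comment> \<open>Condition (2) puts a point of \<open>?U\<close> into each block with positive
    index; for block 0 the zero vector serves.\<close>
  have rep: "\<exists>u\<in>?U. q u = q x" if "x \<in> V" for x
  proof -
    have "q x \<in> Q" using that q(1) by blast
    then obtain i where i: "i < 2 ^ (r - \<sigma>)" "vec_of_nat i = q x"
      using F2space_vec_of_nat by blast
    show ?thesis
    proof (cases "i = 0")
      case True
      then have "x \<in> block v 0" using i that q(3) by simp
      then have "q 0 = q x" using q(4)[of 0 x] that by simp
      then show ?thesis using U unfolding subspace_iff by blast
    next
      case False
      then have "i \<in> {1..m1 r \<sigma>}" using i(1) indices_eq by blast
      then have "block (pencil_of p) i \<inter> block v i \<in> cosets r (block (pencil_of p) 0 \<inter> block v 0)"
        and "F2.subspace (block (pencil_of p) 0 \<inter> block v 0)"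
        using adj unfolding pencil_adj_iff_block is_subspace_dim_iff_card by blast+
      then have "block (pencil_of p) i \<inter> block v i \<noteq> {}" by (auto simp: cosets_def subspace_iff)
      then obtain u where "u \<in> block (pencil_of p) i" "u \<in> block v i" by blast
      then show ?thesis
        using i q(3) block_pencil_of[OF labellingD(1)[OF p]] by (intro bexI[of _ u]) auto
    qed
  qed
  have "q (x + y) = q x + q y" if xy: "x \<in> V" "y \<in> V" for x y
  proof -
    obtain u w where uw: "u \<in> ?U" "w \<in> ?U" "q u = q x" "q w = q y"
      using rep[OF xy(1)] rep[OF xy(2)] by blast
    \<comment> \<open>Replacing \<open>x\<close> and \<open>y\<close> by \<open>u\<close> and
      \<open>w\<close> changes the sum only by an element of \<open>block v 0\<close>, hence not its
      label. As \<open>u + w\<close> lies in \<open>?U\<close>, its label is given by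
      \<open>p\<close>.\<close>
    have "(x + u) + (y + w) \<in> block v 0"
      using uw xy q(4)[of x u] q(4)[of y w] F2.subspace_add[OF S, of "x + u" "y + w"] by simp
    moreover have "(x + u) + (y + w) = (x + y) + (u + w)" by (simp add: algebra_simps)
    ultimately have "q (x + y) = q (u + w)"
      using q(4)[of "x + y" "u + w"] uw(1,2) xy by simp
    also have "\<dots> = p (u + w)" using F2.subspace_add[OF U uw(1,2)] by simp
    also have "\<dots> = q x + q y" using labellingD(5)[OF p] uw by simp
    finally show ?thesis .
  qed
  then have "labelling q" using q(1) by (simp add: labelling_def additive_on_def)
  then show thesis using that q(2) by blast
qed


section \<open>Adjacency as a rank-one change\<close>

text \<open>The vector \<open>s\<close> in the kernel of \<open>p\<close> with
  \<open>f s = 1\<close> keeps the new map surjective and makes its kernel different from that of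
  \<open>p\<close>.\<close>

definition rank_one_step :: "(vec2 \<Rightarrow> vec2) \<Rightarrow> (vec2 \<Rightarrow> bit) \<Rightarrow> vec2 \<Rightarrow> (vec2 \<Rightarrow> vec2) \<Rightarrow> bool" where
  "rank_one_step p f a q \<longleftrightarrow> a \<in> Q \<and> a \<noteq> 0 \<and> additive_on V f \<and>
     (\<exists>s\<in>V. p s = 0 \<and> f s = 1) \<and> (\<forall>x\<in>V. q x = p x + scale2 (f x) a)"

lemma rank_one_step_eq_iff:
  assumes "rank_one_step p f a q" "x \<in> V" shows "p x = q x \<longleftrightarrow> f x = 0"
  using assms by (cases "f x") (auto simp: rank_one_step_def)

text \<open>Adding \<open>s\<close> flips \<open>f\<close> and leaves \<open>p\<close> unchanged, so
  every fibre of \<open>p\<close> contains a point that the step does not move.\<close>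

lemma rank_one_step_rep:
  assumes p: "labelling p" and st: "rank_one_step p f a q" and x: "x \<in> V"
  obtains u where "u \<in> V" "f u = 0" "p u = p x"
proof -
  from st obtain s where s: "s \<in> V" "p s = 0" "f s = 1" and f: "additive_on V f"
    by (auto simp: rank_one_step_def)
  show thesis
  proof (cases "f x")
    case zero
    then show ?thesis using x by (intro that[of x]) auto
  next
    case one
    then show ?thesis using x s labellingD[OF p] additive_onD[OF f x s(1)]
      by (intro that[of "x + s"]) auto
  qed
qed

lemma labelling_rank_one_step:
  assumes p: "labelling p" and st: "rank_one_step p f a q"
  shows "labelling q"
proof -
  have f: "additive_on V f" and a: "a \<in> Q" and q: "\<And>x. x \<in> V \<Longrightarrow> q x = p x + scale2 (f x) a"
    using st by (auto simp: rank_one_step_def)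
  have "q (x + y) = q x + q y" if "x \<in> V" "y \<in> V" for x y
    unfolding q[OF V_closed(2)[OF that]] q[OF that(1)] q[OF that(2)]
      labellingD(5)[OF p that] additive_onD[OF f that] F2.scale_left_distrib
    by (simp only: add_ac)
  moreover have "q ` V = Q"
  proof
    show "q ` V \<subseteq> Q"
    proof (rule image_subsetI)
      fix x assume x: "x \<in> V"
      show "q x \<in> Q"
        unfolding q[OF x]
        by (intro F2.subspace_add F2.subspace_scale subspace_F2space a labellingD(3)[OF p x])
    qed
  next
    show "Q \<subseteq> q ` V"
    proof
      fix y assume "y \<in> Q"
      then obtain x where x: "x \<in> V" "p x = y" by (rule labelling_surj[OF p])
      obtain u where u: "u \<in> V" "f u = 0" "p u = p x" by (rule rank_one_step_rep[OF p st x(1)])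
      then have "q u = y" using q[OF u(1)] x by simp
      then show "y \<in> q ` V" using u(1) by blast
    qed
  qed
  ultimately show ?thesis by (simp add: labelling_def additive_on_def)
qed

text \<open>For additive maps the sets in question are automatically subspaces, and a nonempty fibre
  of \<open>p\<close> on \<open>?U\<close> is automatically a coset of \<open>?T\<close>. What
  remains of adjacency is two cardinalities and the nonemptiness of the fibres.\<close>

lemma pencil_of_adj_iff:
  assumes p: "labelling p" and q: "labelling q"
  shows "pencil_adj r \<sigma> (pencil_of p) (pencil_of q) \<longleftrightarrow>
     card {x\<in>V. p x = 0 \<and> q x = 0} = 2 ^ (\<sigma> - 1) \<and> card {x\<in>V. p x = q x} = 2 ^ (r - 1) \<and>
     (\<forall>i\<in>{1..m1 r \<sigma>}. \<exists>x\<in>V. p x = vec_of_nat i \<and> q x = vec_of_nat i)"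
proof -
  let ?T = "{x\<in>V. p x = 0 \<and> q x = 0}" and ?U = "{x\<in>V. p x = q x}"
  have V: "F2.subspace V" by (rule subspace_F2space)
  have U: "F2.subspace ?U" using subspace_agree[OF V labellingD(1)[OF p] labellingD(1)[OF q]] .
  have pU: "additive_on ?U p" using labellingD(1)[OF p] by (rule additive_on_subset) auto
  have T_U: "?T = {x\<in>?U. p x = 0}" by auto
  have T: "F2.subspace ?T" unfolding T_U using subspace_kernel[OF U pU] .
  have blk: "block (pencil_of p) i \<inter> block (pencil_of q) i = {x\<in>?U. p x = vec_of_nat i}"
    if "i < 2 ^ (r - \<sigma>)" for i
    using that by (auto simp: block_pencil_of labellingD(1)[OF p] labellingD(1)[OF q])
  have blk0: "block (pencil_of p) 0 \<inter> block (pencil_of q) 0 = ?T"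
    unfolding T_U by (rule blk[of 0, unfolded vec_of_nat_0]) simp
  have pQ: "p ` V \<subseteq> Q" using labellingD(2)[OF p] by simp
  have un: "(\<Union>i<2 ^ (r - \<sigma>). block (pencil_of p) i \<inter> block (pencil_of q) i) = ?U"
    by (rule union_agree[OF pQ block_pencil_of[OF labellingD(1)[OF p]] block_pencil_of[OF labellingD(1)[OF q]]])
  have "block (pencil_of p) i \<inter> block (pencil_of q) i \<in> cosets r ?T - {?T} \<longleftrightarrow>
      (\<exists>x\<in>V. p x = vec_of_nat i \<and> q x = vec_of_nat i)" (is "?L \<longleftrightarrow> ?R")
    if i: "i \<in> {1..m1 r \<sigma>}" for i
  proof
    have i': "i < 2 ^ (r - \<sigma>)" using i indices_eq by blast
    show ?R if ?L
    proof -
      from that have "block (pencil_of p) i \<inter> block (pencil_of q) i \<noteq> {}"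
        using T by (auto simp: cosets_def subspace_iff)
      then show ?R using blk[OF i'] by auto
    qed
    show ?L if ?R
    proof -
      from that obtain x where "x \<in> V" "p x = vec_of_nat i" "q x = vec_of_nat i" by blast
      then have x: "x \<in> ?U" "p x = vec_of_nat i" by simp_all
      have "{y\<in>?U. p y = p x} = (+) x ` {y\<in>?U. p y = 0}"
        using fibre_eq_coset[OF U pU x(1)] .
      then have "{y\<in>?U. p y = vec_of_nat i} \<in> cosets r ?T"
        unfolding T_U[symmetric] x(2) cosets_def using x(1) by blast
      moreover have "vec_of_nat i \<noteq> 0"
        using i inj_vec_of_nat vec_of_nat_0 by (metis atLeastAtMost_iff injD not_one_le_zero)
      then have "x \<notin> ?T" using x by simp
      then have "{y\<in>?U. p y = vec_of_nat i} \<noteq> ?T" using x by blast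
      ultimately show ?L using blk[OF i'] by simp
    qed
  qed
  then show ?thesis
    unfolding pencil_adj_iff_block blk0 un is_subspace_dim_iff_card using T U by auto
qed

lemma rank_one_step_adj:
  assumes p: "labelling p" and st: "rank_one_step p f a q"
  shows "pencil_adj r \<sigma> (pencil_of p) (pencil_of q)"
proof -
  have q: "labelling q" using labelling_rank_one_step[OF p st] .
  from st obtain s where s: "s \<in> V" "p s = 0" "f s = 1" and f: "additive_on V f"
    and qx: "\<And>x. x \<in> V \<Longrightarrow> q x = p x + scale2 (f x) a"
    by (auto simp: rank_one_step_def)
  let ?S = "{x\<in>V. p x = 0}"
  have "2 * card {x\<in>V. f x = 0} = 2 ^ r"
    using card_eq_twice_kernel[OF subspace_F2space f finite_F2space s(1,3)]
    unfolding card_F2space by (rule sym)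
  then have "card {x\<in>V. f x = 0} = 2 ^ (r - 1)"
    by (rule half_power) (use sigma_less in simp)
  moreover have "{x\<in>V. p x = q x} = {x\<in>V. f x = 0}"
    by (rule Collect_cong) (use rank_one_step_eq_iff[OF st] in blast)
  ultimately have U: "card {x\<in>V. p x = q x} = 2 ^ (r - 1)" by (simp only:)
  have "card ?S = 2 * card {x\<in>?S. f x = 0}"
    using s by (intro card_eq_twice_kernel[of _ _ s] additive_on_subset[OF f]
        subspace_kernel[OF subspace_F2space labellingD(1)[OF p]]) auto
  then have "2 * card {x\<in>?S. f x = 0} = 2 ^ \<sigma>" unfolding card_kernel[OF p] by (rule sym)
  then have "card {x\<in>?S. f x = 0} = 2 ^ (\<sigma> - 1)" using sigma_pos by (rule half_power)
  moreover have "{x\<in>?S. f x = 0} = {x\<in>V. p x = 0 \<and> q x = 0}"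
  proof (rule Collect_cong)
    fix x show "x \<in> ?S \<and> f x = 0 \<longleftrightarrow> x \<in> V \<and> p x = 0 \<and> q x = 0"
      using rank_one_step_eq_iff[OF st, of x] by auto
  qed
  ultimately have T: "card {x\<in>V. p x = 0 \<and> q x = 0} = 2 ^ (\<sigma> - 1)" by (simp only:)
  have "\<exists>x\<in>V. p x = vec_of_nat i \<and> q x = vec_of_nat i" if i: "i \<in> {1..m1 r \<sigma>}" for i
  proof -
    have "i < 2 ^ (r - \<sigma>)" using i indices_eq by blast
    then have "vec_of_nat i \<in> Q" by (rule vec_of_nat_in_F2space)
    then obtain x where x: "x \<in> V" "p x = vec_of_nat i" by (rule labelling_surj[OF p])
    obtain u where u: "u \<in> V" "f u = 0" "p u = p x" by (rule rank_one_step_rep[OF p st x(1)])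
    then show ?thesis using x(2) qx[OF u(1)] by (intro bexI[of _ u]) auto
  qed
  then show ?thesis unfolding pencil_of_adj_iff[OF p q] using T U by blast
qed

text \<open>The difference of the two maps is additive and vanishes on a subspace of index 2, so it
  takes only one nonzero value.\<close>

lemma adj_rank_one_step:
  assumes p: "labelling p" and q: "labelling q"
    and adj: "pencil_adj r \<sigma> (pencil_of p) (pencil_of q)"
  obtains f a where "rank_one_step p f a q"
proof -
  let ?U = "{x\<in>V. p x = q x}" and ?S = "{x\<in>V. p x = 0}"
  have U: "F2.subspace ?U"
    using subspace_agree[OF subspace_F2space labellingD(1)[OF p] labellingD(1)[OF q]] .
  have cU: "card ?U = 2 ^ (r - 1)" and cT: "card {x\<in>V. p x = 0 \<and> q x = 0} = 2 ^ (\<sigma> - 1)"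
    using adj pencil_of_adj_iff[OF p q] by auto
  \<comment> \<open>Otherwise the common kernel would be the whole kernel of \<open>p\<close>, with
    \<open>2 ^ \<sigma>\<close> elements instead of half as many.\<close>
  have "\<not> ?S \<subseteq> ?U"
  proof
    assume "?S \<subseteq> ?U"
    then have "?S = {x\<in>V. p x = 0 \<and> q x = 0}" by auto
    then have "(2::nat) ^ \<sigma> = 2 ^ (\<sigma> - 1)" using cT card_kernel[OF p] by (simp only:)
    then show False using sigma_pos by simp
  qed
  then obtain s where s: "s \<in> V" "p s = 0" "p s \<noteq> q s" by blast
  \<comment> \<open>By counting, \<open>?U\<close> and its translate by \<open>s\<close> fill
    \<open>V\<close>. Hence outside \<open>?U\<close> the maps differ by the same vector as at
    \<open>s\<close>, namely \<open>q s\<close>, because \<open>p s = 0\<close>.\<close>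
  have V_split: "x \<in> ?U \<or> s + x \<in> ?U" if x: "x \<in> V" for x
  proof -
    define U where "U = ?U"
    have sU: "s \<notin> U" using s(3) by (simp add: U_def)
    have U_sub: "F2.subspace U" "U \<subseteq> V" using U by (auto simp: U_def)
    have "U \<inter> (+) s ` U = {}" using sU subspace_cancel_right[OF U_sub(1)] by auto
    moreover have "finite U" using U_sub(2) finite_F2space by (rule finite_subset)
    moreover have "card ((+) s ` U) = card U" by (rule card_image) simp
    ultimately have "card (U \<union> (+) s ` U) = 2 * card U" by (simp add: card_Un_disjoint)
    also have "\<dots> = card V" using cU sigma_less by (cases r) (auto simp: card_F2space U_def)
    finally have "U \<union> (+) s ` U = V" using s(1) U_sub(2) by (intro card_subset_eq) auto
    then have "x \<in> U \<or> s + x \<in> U" using x unfolding mem_coset_iff[symmetric] by blast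
    then show ?thesis by (simp only: U_def)
  qed
  define f :: "vec2 \<Rightarrow> bit" where "f x = of_bool (p x \<noteq> q x)" for x
  have step: "q x = p x + scale2 (f x) (q s)" if x: "x \<in> V" for x
  proof (cases "p x = q x")
    case False
    then have "p (s + x) = q (s + x)" using V_split[OF x] by blast
    then have "p x = q s + q x"
      unfolding labellingD(5)[OF p s(1) x] labellingD(5)[OF q s(1) x] s(2) by simp
    then show ?thesis using False by (simp add: f_def add.commute)
  qed (simp add: f_def)
  have qs: "q s \<noteq> 0" using s by auto
  \<comment> \<open>Both maps are additive, so the two coefficients give the same multiple of
    \<open>q s\<close>, and a nonzero vector can be cancelled.\<close>
  have "f (x + y) = f x + f y" if xy: "x \<in> V" "y \<in> V" for x y
  proof -
    have "(p x + p y) + scale2 (f (x + y)) (q s) = (p x + p y) + scale2 (f x + f y) (q s)"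
      using labellingD(5)[OF q xy]
      unfolding step[OF xy(1)] step[OF xy(2)] step[OF V_closed(2)[OF xy]] labellingD(5)[OF p xy]
        F2.scale_left_distrib
      by (simp only: add_ac)
    then have "scale2 (f (x + y)) (q s) = scale2 (f x + f y) (q s)" by (rule add_left_imp_eq)
    then show ?thesis using qs by simp
  qed
  then have "additive_on V f" by (simp add: additive_on_def)
  moreover have "f s = 1" using s(3) by (simp add: f_def)
  ultimately have "rank_one_step p f (q s) q"
    unfolding rank_one_step_def using qs s(1,2) step labellingD(3)[OF q s(1)] by blast
  then show thesis using that by blast
qed

section \<open>The labelling of the base pencil\<close>

definition base_labelling :: "vec2 \<Rightarrow> vec2" where
  "base_labelling x = (\<lambda>i. x (i + \<sigma>))"

text \<open>Dropping the \<open>\<sigma>\<close> lowest digits is division by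
  \<open>2 ^ \<sigma>\<close>, whose quotient is the index of the interval that contains
  \<open>n\<close>.\<close>

lemma base_labelling_vec_of_nat: "base_labelling (vec_of_nat n) = vec_of_nat (n div 2 ^ \<sigma>)"
  by (simp add: base_labelling_def vec_of_nat_def fun_eq_iff add.commute bit_drop_bit_eq
      flip: drop_bit_eq_div)

lemma labelling_base: "labelling base_labelling"
proof -
  have "base_labelling ` V = Q"
  proof
    show "base_labelling ` V \<subseteq> Q" by (auto simp: base_labelling_def F2space_def)
    show "Q \<subseteq> base_labelling ` V"
    proof
      fix y assume y: "y \<in> Q"
      have "y = base_labelling (\<lambda>i. if i < \<sigma> then 0 else y (i - \<sigma>))"
        by (simp add: base_labelling_def)
      moreover have "(\<lambda>i. if i < \<sigma> then 0 else y (i - \<sigma>)) \<in> V"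
        using y by (auto simp: F2space_def)
      ultimately show "y \<in> base_labelling ` V" by blast
    qed
  qed
  then show ?thesis by (simp add: labelling_def additive_on_def base_labelling_def fun_eq_iff)
qed

lemma base_pencil_eq: "base_pencil r \<sigma> = pencil_of base_labelling"
proof (rule eq_pencil_ofI)
  have m: "m1 r \<sigma> + 1 = 2 ^ (r - \<sigma>)" by (simp add: m1_def)
  show "length (base_pencil r \<sigma>) = 2 ^ (r - \<sigma>)" by (simp add: base_pencil_def m1_def)
  show "0 \<notin> base_pencil r \<sigma> ! 0"
  proof
    assume "0 \<in> base_pencil r \<sigma> ! 0"
    then obtain n where "n \<ge> 1" "vec_of_nat n = vec_of_nat 0" by (auto simp: base_pencil_def)
    then have "n = 0" by (intro injD[OF inj_vec_of_nat])
    then show False using \<open>n \<ge> 1\<close> by simp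
  qed
  fix i :: nat assume i: "i < 2 ^ (r - \<sigma>)"
  have "block (base_pencil r \<sigma>) i = vec_of_nat ` {i * 2 ^ \<sigma>..<(i + 1) * 2 ^ \<sigma>}"
  proof (cases "i = 0")
    case True
    \<comment> \<open>Entry 0 of the base pencil starts at 1; \<open>block\<close> supplies the
      missing vector of the number 0.\<close>
    have "{0..<2 ^ \<sigma>} = insert 0 {1..2 ^ \<sigma> - 1 :: nat}" by (auto simp: Suc_le_eq)
    then show ?thesis using True by (simp add: block_def base_pencil_def)
  next
    case False
    have "{a..<b} = {a..b - 1}" if "0 < b" for a b :: nat using that by auto
    from this[of "(i + 1) * 2 ^ \<sigma>" "i * 2 ^ \<sigma>"]
    have "{i * 2 ^ \<sigma>..<(i + 1) * 2 ^ \<sigma>} = {i * 2 ^ \<sigma>..(i + 1) * 2 ^ \<sigma> - 1}" by simp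
    then show ?thesis using False i m by (simp add: block_def base_pencil_def nth_Cons' del: upt_Suc)
  qed
  also have "{i * 2 ^ \<sigma>..<(i + 1) * 2 ^ \<sigma>} = {n. n div 2 ^ \<sigma> = i}"
  proof (intro set_eqI iffI)
    fix n assume "n \<in> {i * 2 ^ \<sigma>..<(i + 1) * 2 ^ \<sigma>}"
    then have "n div 2 ^ \<sigma> = i" by (intro div_nat_eqI) (auto simp: mult.commute)
    then show "n \<in> {n. n div 2 ^ \<sigma> = i}" by simp
  next
    fix n assume "n \<in> {n. n div 2 ^ \<sigma> = i}"
    then show "n \<in> {i * 2 ^ \<sigma>..<(i + 1) * 2 ^ \<sigma>}"
      using dividend_less_times_div[of "2 ^ \<sigma>" n] times_div_less_eq_dividend[of "2 ^ \<sigma>" n]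
      by (auto simp: algebra_simps)
  qed
  also have "\<dots> = {n. n < 2 ^ r \<and> n div 2 ^ \<sigma> = i}"
  proof -
    have "n < 2 ^ r" if "n div 2 ^ \<sigma> = i" for n
    proof -
      have "n < 2 ^ (r - \<sigma>) * 2 ^ \<sigma>"
        using that i div_less_iff_less_mult[of "2 ^ \<sigma>" n "2 ^ (r - \<sigma>)"] by simp
      then show ?thesis using sigma_less by (simp flip: power_add)
    qed
    then show ?thesis by auto
  qed
  also have "vec_of_nat ` \<dots> = {x\<in>V. base_labelling x = vec_of_nat i}"
  proof (intro set_eqI iffI)
    fix x assume "x \<in> vec_of_nat ` {n. n < 2 ^ r \<and> n div 2 ^ \<sigma> = i}"
    then show "x \<in> {x\<in>V. base_labelling x = vec_of_nat i}"
      by (auto simp: base_labelling_vec_of_nat vec_of_nat_in_F2space)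
  next
    fix x assume x: "x \<in> {x\<in>V. base_labelling x = vec_of_nat i}"
    then obtain n where n: "n < 2 ^ r" "vec_of_nat n = x" using F2space_vec_of_nat by blast
    then have "vec_of_nat (n div 2 ^ \<sigma>) = vec_of_nat i"
      using x by (auto simp: base_labelling_vec_of_nat)
    then have "n div 2 ^ \<sigma> = i" by (rule injD[OF inj_vec_of_nat])
    then show "x \<in> vec_of_nat ` {n. n < 2 ^ r \<and> n div 2 ^ \<sigma> = i}" using n by blast
  qed
  finally show "block (base_pencil r \<sigma>) i = {x\<in>V. base_labelling x = vec_of_nat i}" .
qed


section \<open>Transvections and the distance-2 graph\<close>

lemma pencil_of_cong: "(\<And>x. x \<in> V \<Longrightarrow> p x = q x) \<Longrightarrow> pencil_of p = pencil_of q"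
  unfolding pencil_of_def by (intro map_cong refl arg_cong2[of _ _ _ _ "(-)"] Collect_cong) auto

lemma pencil_of_eqD:
  assumes p: "labelling p" and q: "labelling q" and eq: "pencil_of p = pencil_of q" and x: "x \<in> V"
  shows "p x = q x"
proof -
  obtain i where i: "i < 2 ^ (r - \<sigma>)" "vec_of_nat i = p x"
    using F2space_vec_of_nat[OF labellingD(3)[OF p x]] by blast
  then have "x \<in> block (pencil_of p) i" using x block_pencil_of[OF labellingD(1)[OF p] i(1)] by simp
  then show ?thesis unfolding eq block_pencil_of[OF labellingD(1)[OF q] i(1)] using i(2) by simp
qed

section \<open>The component of the base pencil and the set \<open>W_set\<close> in terms of
  labellings\<close>

lemma verts_G_iff:
  "v \<in> verts (G_graph r \<sigma>) \<longleftrightarrow>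
     ordered_pencil r \<sigma> v \<and> (base_pencil r \<sigma>, v) \<in> (edges (pencil_graph r \<sigma>))\<^sup>*"
  by (simp add: G_graph_def component_def induced_subgraph_def pencil_graph_def)

lemma edges_G_iff:
  "(u, v) \<in> edges (G_graph r \<sigma>) \<longleftrightarrow>
     u \<in> verts (G_graph r \<sigma>) \<and> v \<in> verts (G_graph r \<sigma>) \<and> pencil_adj r \<sigma> u v"
  unfolding verts_G_iff by (auto simp: G_graph_def component_def induced_subgraph_def pencil_graph_def)

text \<open>Additivity is carried along a path from the base pencil, one edge at a time.\<close>

lemma verts_G_labelling:
  assumes "v \<in> verts (G_graph r \<sigma>)"
  obtains p where "labelling p" "v = pencil_of p"
proof -
  have "(base_pencil r \<sigma>, v) \<in> (edges (pencil_graph r \<sigma>))\<^sup>*" using assms verts_G_iff by blast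
  then have "\<exists>p. labelling p \<and> v = pencil_of p"
  proof (induction rule: rtrancl_induct)
    case base
    then show ?case using labelling_base base_pencil_eq by blast
  next
    case (step u v)
    then obtain p where "labelling p" "u = pencil_of p" by blast
    moreover have "ordered_pencil r \<sigma> v" "pencil_adj r \<sigma> u v"
      using step.hyps(2) by (simp_all add: pencil_graph_def)
    ultimately show ?case using adjacent_labelling by metis
  qed
  then show thesis using that by blast
qed

lemma base_in_verts_G: "base_pencil r \<sigma> \<in> verts (G_graph r \<sigma>)"
  unfolding verts_G_iff using ordered_pencil_of[OF labelling_base] base_pencil_eq by simp

lemma rank_one_step_edge:
  assumes p: "labelling p" "pencil_of p \<in> verts (G_graph r \<sigma>)" and st: "rank_one_step p f a q"
  shows "(pencil_of p, pencil_of q) \<in> edges (G_graph r \<sigma>)"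
proof -
  have adj: "pencil_adj r \<sigma> (pencil_of p) (pencil_of q)" using p(1) st by (rule rank_one_step_adj)
  have "ordered_pencil r \<sigma> (pencil_of q)"
    using labelling_rank_one_step[OF p(1) st] by (rule ordered_pencil_of)
  moreover from this have "(pencil_of p, pencil_of q) \<in> edges (pencil_graph r \<sigma>)"
    using ordered_pencil_of[OF p(1)] adj by (simp add: pencil_graph_def)
  ultimately have "pencil_of q \<in> verts (G_graph r \<sigma>)"
    using p(2) unfolding verts_G_iff by (meson rtrancl.rtrancl_into_rtrancl)
  then show ?thesis using p(2) adj by (simp add: edges_G_iff)
qed

definition W_labelling :: "(vec2 \<Rightarrow> vec2) \<Rightarrow> bool" where
  "W_labelling p \<longleftrightarrow> labelling p \<and> pencil_of p \<in> verts (G_graph r \<sigma>) \<and>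
     (\<forall>x\<in>V. p x = 0 \<longleftrightarrow> base_labelling x = 0)"

lemma W_labellingD:
  assumes "W_labelling p"
  shows "labelling p" "pencil_of p \<in> verts (G_graph r \<sigma>)"
    "\<And>x. x \<in> V \<Longrightarrow> p x = 0 \<longleftrightarrow> base_labelling x = 0"
  using assms by (simp_all add: W_labelling_def)

lemma W_labelling_iff:
  assumes p: "labelling p" "pencil_of p \<in> verts (G_graph r \<sigma>)"
  shows "W_labelling p \<longleftrightarrow> pencil_of p \<in> W_set r \<sigma>"
proof -
  have z: "p 0 = 0" "base_labelling 0 = 0" using labellingD(4) p(1) labelling_base by auto
  have "pencil_of p ! 0 = base_pencil r \<sigma> ! 0 \<longleftrightarrow>
      {x\<in>V. p x = 0} - {0} = {x\<in>V. base_labelling x = 0} - {0}"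
    unfolding base_pencil_eq by (simp add: nth_pencil_of)
  also have "\<dots> \<longleftrightarrow> (\<forall>x\<in>V. p x = 0 \<longleftrightarrow> base_labelling x = 0)" using z by (auto simp: set_eq_iff)
  finally show ?thesis using p by (simp add: W_labelling_def W_set_def)
qed

lemma W_set_labelling:
  assumes "w \<in> W_set r \<sigma>" obtains p where "W_labelling p" "w = pencil_of p"
proof -
  have "w \<in> verts (G_graph r \<sigma>)" using assms by (simp add: W_set_def)
  moreover from this obtain p where "labelling p" "w = pencil_of p" by (rule verts_G_labelling)
  ultimately show thesis using W_labelling_iff assms that by blast
qed

lemma W_labelling_in_W: "W_labelling p \<Longrightarrow> pencil_of p \<in> W_set r \<sigma>"
  using W_labelling_iff W_labellingD by blast

lemma edges_H_iff:
  "(u, v) \<in> edges (H_graph r \<sigma>) \<longleftrightarrow>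
     u \<in> W_set r \<sigma> \<and> v \<in> W_set r \<sigma> \<and> graph_dist (G_graph r \<sigma>) u v = 2"
  by (auto simp: H_graph_def induced_subgraph_def distance2_graph_def W_set_def)

section \<open>The subspace \<open>E\<close> of agreement with the base map, and its growth along
  edges of \<open>H_graph\<close>\<close>

definition agreement :: "(vec2 \<Rightarrow> vec2) \<Rightarrow> vec2 set" where
  "agreement p = {x\<in>V. p x = base_labelling x}"

lemma agreement_iff: "x \<in> agreement p \<longleftrightarrow> x \<in> V \<and> p x = base_labelling x"
  by (simp add: agreement_def)

lemma agreement_subset: "agreement p \<subseteq> V"
  by (auto simp: agreement_def)

lemma finite_agreement: "finite (agreement p)"
  using agreement_subset finite_F2space by (rule finite_subset)

lemma subspace_agreement: "labelling p \<Longrightarrow> F2.subspace (agreement p)"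
  unfolding agreement_def
  by (intro subspace_agree subspace_F2space labellingD(1) labelling_base)

lemma card_agreement_le: "card (agreement p) \<le> 2 ^ r"
  using card_mono[OF finite_F2space agreement_subset] by (simp add: card_F2space)

lemma H_edge_card_agreement:
  assumes p: "W_labelling p" and q: "W_labelling q"
    and e: "(pencil_of p, pencil_of q) \<in> edges (H_graph r \<sigma>)"
  shows "card (agreement q) \<le> 2 * card (agreement p)"
proof -
  have "graph_dist (G_graph r \<sigma>) (pencil_of p) (pencil_of q) = enat 2"
    using e by (simp add: edges_H_iff numeral_eq_enat)
  then have "(pencil_of p, pencil_of q) \<in> edges (G_graph r \<sigma>) ^^ 2" by (rule graph_dist_attained)
  then obtain v where v: "(pencil_of p, v) \<in> edges (G_graph r \<sigma>)" "(v, pencil_of q) \<in> edges (G_graph r \<sigma>)"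
    by (auto simp: numeral_2_eq_2)
  then have "v \<in> verts (G_graph r \<sigma>)" by (simp add: edges_G_iff)
  then obtain m where m: "labelling m" "v = pencil_of m" by (rule verts_G_labelling)
  note lp = W_labellingD(1)[OF p] and lq = W_labellingD(1)[OF q]
  have "pencil_adj r \<sigma> (pencil_of p) (pencil_of m)" "pencil_adj r \<sigma> (pencil_of m) (pencil_of q)"
    using v m by (simp_all add: edges_G_iff)
  then obtain f a g c where f: "rank_one_step p f a m" and g: "rank_one_step m g c q"
    using adj_rank_one_step lp lq m(1) by metis
  have q_eq: "q x = p x + scale2 (f x) a + scale2 (g x) c" if "x \<in> V" for x
    using f g that by (simp add: rank_one_step_def)
  obtain s where s: "s \<in> V" "p s = 0" "f s = 1" using f by (auto simp: rank_one_step_def)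
  \<comment> \<open>Both kernels are the base kernel, so \<open>q\<close> kills \<open>s\<close> as
    well. Since \<open>a\<close> is nonzero, the second step must undo the first at
    \<open>s\<close>; this is possible only with \<open>g s = 1\<close> and
    \<open>c = a\<close>.\<close>
  have "q s = 0" using s p q W_labellingD(3) by blast
  then have ac: "a + scale2 (g s) c = 0" using q_eq[OF s(1)] s by simp
  moreover have "a \<noteq> 0" using f by (simp add: rank_one_step_def)
  ultimately have "c = a" by (cases "g s") auto
  define h where "h = (\<lambda>x. f x + g x)"
  have q_h: "q x = p x + scale2 (h x) a" if "x \<in> V" for x
    using q_eq[OF that] unfolding h_def F2.scale_left_distrib \<open>c = a\<close> by (simp only: add.assoc)
  have "additive_on V f" "additive_on V g" using f g by (simp_all add: rank_one_step_def)
  then have "additive_on V h" unfolding h_def by (rule additive_on_add)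
  then have "card (agreement q) \<le> 2 * card {x\<in>agreement q. h x = 0}"
    by (intro card_le_twice_kernel subspace_agreement lq finite_agreement)
      (rule additive_on_subset[OF _ agreement_subset])
  \<comment> \<open>Where \<open>h\<close> vanishes, \<open>q\<close> and \<open>p\<close> coincide,
    so agreement of \<open>q\<close> with the base map is agreement of \<open>p\<close>.\<close>
  also have "card {x\<in>agreement q. h x = 0} \<le> card (agreement p)"
    by (intro card_mono finite_agreement) (auto simp: agreement_iff q_h)
  finally show ?thesis by simp
qed

text \<open>The transvection adds \<open>a = p x + base_labelling x\<close> wherever a suitable
  functional \<open>f\<close> is 1. It is then realised by two adjacencies through a pencil with
  another kernel.\<close>

lemma H_descent:
  assumes p: "W_labelling p" and x: "x \<in> V" "p x \<noteq> base_labelling x"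
  obtains q where "W_labelling q" "(pencil_of p, pencil_of q) \<in> edges (H_graph r \<sigma>)"
    "2 * card (agreement p) \<le> card (agreement q)"
proof -
  let ?b = base_labelling and ?E = "agreement p"
  note lp = W_labellingD(1)[OF p] and ker = W_labellingD(3)[OF p]
  note E = subspace_agreement[OF lp]
  have xE: "x \<notin> ?E" using x by (simp add: agreement_iff)
  obtain z where z: "z \<in> V" "p z = ?b x"
    using labelling_surj[OF lp labellingD(3)[OF labelling_base x(1)]] by blast
  \<comment> \<open>As \<open>z\<close> lies over the target value of \<open>x\<close>, the vector
    \<open>y\<close> lies over the direction \<open>a\<close> in which \<open>p x\<close> has to
    move.\<close>
  define y where "y = x + z"
  have yx: "y + x = z" unfolding y_def add.commute[of "x + z"] by (rule vec2_add_self_left)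
  define a where "a = p x + ?b x"
  have y: "y \<in> V" "p y = a"
    using x z labellingD(5)[OF lp x(1) z(1)] by (simp_all add: y_def a_def)
  have a: "a \<in> Q" "a \<noteq> 0" using y x(2) labellingD(3)[OF lp y(1)] by (simp_all add: a_def)
  \<comment> \<open>If \<open>z\<close> were in \<open>?E\<close>, the base map would agree at
    \<open>x\<close> and \<open>z\<close> and so kill \<open>y\<close>; the common kernel would then
    give \<open>p y = 0\<close>, against \<open>a\<close> being nonzero.\<close>
  have zE: "z \<notin> ?E"
  proof
    assume "z \<in> ?E"
    then have "?b y = 0"
      using z labellingD(5)[OF labelling_base x(1) z(1)] by (simp add: agreement_iff y_def)
    then show False using ker[OF y(1)] y(2) a(2) by simp
  qed
  \<comment> \<open>Vanishing on \<open>?E\<close> preserves the agreement reached so far, and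
    vanishing at \<open>y\<close> preserves the kernel. The two facts \<open>xE\<close> and
    \<open>zE\<close> say exactly that \<open>x\<close> avoids both cosets.\<close>
  let ?K = "?E \<union> (+) y ` ?E"
  have "F2.subspace ?K" using E by (rule subspace_Un_translate)
  moreover have "?K \<subseteq> V" using agreement_subset[of p] y(1) by (auto simp: subset_iff)
  moreover have "x \<notin> ?K" using xE zE by (simp add: mem_coset_iff yx)
  ultimately obtain f :: "vec2 \<Rightarrow> bit" where f: "additive_on V f" "\<forall>k\<in>?K. f k = 0" "f x = 1"
    by (rule separating_functional[OF _ _ x(1)])
  have fE: "f e = 0" if "e \<in> ?E" for e using f(2) that by blast
  have "y \<in> ?K" using E by (simp add: mem_coset_iff subspace_iff)
  then have fy: "f y = 0" by (rule bspec[OF f(2)])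
  \<comment> \<open>The kernel is nontrivial because \<open>\<sigma>\<close> is positive. A
    functional \<open>g\<close> with \<open>g s = 1\<close> supplies the detour: it makes the first
    step legal.\<close>
  obtain s where s: "s \<in> V" "p s = 0" "s \<noteq> 0"
  proof -
    have "(2::nat) \<le> 2 ^ \<sigma>" using sigma_pos by (cases \<sigma>) auto
    then have "\<not> {v\<in>V. p v = 0} \<subseteq> {0}"
      using card_mono[of "{0}" "{v\<in>V. p v = 0}"] card_kernel[OF lp] by auto
    then show thesis using that by blast
  qed
  have "F2.subspace {0}" "{0} \<subseteq> V" "s \<notin> {0}" using s(3) by (simp_all add: subspace_iff)
  then obtain g :: "vec2 \<Rightarrow> bit" where g: "additive_on V g" "g s = 1" by (rule separating_functional[OF _ _ s(1)])
  have sE: "s \<in> ?E" using s(1,2) ker[OF s(1)] by (simp add: agreement_iff)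
  define m where "m v = p v + scale2 (g v) a" for v
  define h where "h = (\<lambda>v. g v + f v)"
  define q where "q v = m v + scale2 (h v) a" for v
  have q: "q v = p v + scale2 (f v) a" for v
  proof -
    have "scale2 (g v) a + scale2 (h v) a = scale2 (f v) a"
      unfolding h_def F2.scale_left_distrib by (rule vec2_add_self_left)
    then show ?thesis by (simp add: q_def m_def add.assoc)
  qed
  have st1: "rank_one_step p g a m"
    unfolding rank_one_step_def using a g s(1,2) by (auto simp: m_def)
  \<comment> \<open>The second step needs a vector in the kernel of \<open>m\<close> at which
    \<open>h\<close> is 1. Over \<open>a\<close>, the value \<open>g t = 1\<close> gives
    \<open>m t = a + a = 0\<close>. Adding \<open>s\<close> to \<open>y\<close> corrects
    \<open>g\<close> and changes neither \<open>p\<close> nor \<open>f\<close>.\<close>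
  define t where "t = (if g y = 1 then y else y + s)"
  have t: "t \<in> V" "g t = 1" "p t = a" "f t = 0"
    using y s g(2) fy fE[OF sE] additive_onD[OF g(1) y(1) s(1)] additive_onD[OF f(1) y(1) s(1)]
      labellingD(5)[OF lp y(1) s(1)]
    by (auto simp: t_def)
  have "additive_on V h" using g(1) f(1) unfolding h_def by (rule additive_on_add)
  moreover have "m t = 0" "h t = 1" using t by (simp_all add: m_def h_def)
  ultimately have st2: "rank_one_step m h a q"
    unfolding rank_one_step_def using a t(1) q_def by blast
  have lm: "labelling m" using labelling_rank_one_step[OF lp st1] .
  have lq: "labelling q" using labelling_rank_one_step[OF lm st2] .
  have e1: "(pencil_of p, pencil_of m) \<in> edges (G_graph r \<sigma>)"
    using rank_one_step_edge[OF lp W_labellingD(2)[OF p] st1] .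
  then have "pencil_of m \<in> verts (G_graph r \<sigma>)" by (simp add: edges_G_iff)
  then have e2: "(pencil_of m, pencil_of q) \<in> edges (G_graph r \<sigma>)"
    using rank_one_step_edge[OF lm _ st2] by blast
  \<comment> \<open>The base kernel lies in \<open>?E\<close>, where \<open>f\<close> vanishes, so
    \<open>q\<close> kills it; equal cardinalities exclude anything more.\<close>
  have "{v\<in>V. ?b v = 0} = {v\<in>V. q v = 0}"
  proof (rule card_subset_eq)
    show "{v\<in>V. ?b v = 0} \<subseteq> {v\<in>V. q v = 0}"
    proof safe
      fix v assume v: "v \<in> V" "?b v = 0"
      then have "p v = 0" using ker by blast
      then show "q v = 0" using fE[of v] v by (simp add: q agreement_iff)
    qed
  qed (simp_all add: card_kernel labelling_base lq)
  then have kerq: "q v = 0 \<longleftrightarrow> ?b v = 0" if "v \<in> V" for v using that by blast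
  have Wq: "W_labelling q"
    unfolding W_labelling_def using lq e2 kerq by (simp add: edges_G_iff)
  have "q x \<noteq> p x" using f(3) a(2) by (simp add: q)
  then have ne: "pencil_of p \<noteq> pencil_of q" using pencil_of_eqD[OF lp lq _ x(1)] by metis
  \<comment> \<open>Adjacency would move some kernel vector, but the two kernels are equal.\<close>
  have nadj: "(pencil_of p, pencil_of q) \<notin> edges (G_graph r \<sigma>)"
  proof
    assume "(pencil_of p, pencil_of q) \<in> edges (G_graph r \<sigma>)"
    then have "pencil_adj r \<sigma> (pencil_of p) (pencil_of q)" by (simp add: edges_G_iff)
    then obtain f' a' where "rank_one_step p f' a' q" by (rule adj_rank_one_step[OF lp lq])
    then obtain u where "u \<in> V" "p u = 0" "q u \<noteq> 0" by (auto simp: rank_one_step_def)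
    then show False using ker kerq by blast
  qed
  have "graph_dist (G_graph r \<sigma>) (pencil_of p) (pencil_of q) = enat 2"
  proof (rule graph_dist_eqI)
    show "(pencil_of p, pencil_of q) \<in> edges (G_graph r \<sigma>) ^^ 2"
      using e1 e2 by (auto simp: numeral_2_eq_2)
  next
    fix n assume n: "(pencil_of p, pencil_of q) \<in> edges (G_graph r \<sigma>) ^^ n"
    then have "n \<noteq> 0" using ne by (intro notI) simp
    moreover have "n \<noteq> 1" using n nadj by (intro notI) simp
    ultimately show "2 \<le> n" by linarith
  qed
  then have "(pencil_of p, pencil_of q) \<in> edges (H_graph r \<sigma>)"
    using W_labelling_in_W[OF p] W_labelling_in_W[OF Wq] by (simp add: edges_H_iff numeral_eq_enat)
  moreover have "2 * card ?E \<le> card (agreement q)"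
  proof -
    have sub: "?E \<subseteq> agreement q" using fE by (auto simp: agreement_iff q)
    \<comment> \<open>At \<open>x\<close> the change is \<open>p x + a\<close>, which is the base
      value. So the new agreement contains \<open>?E\<close> and its disjoint translate by
      \<open>x\<close>.\<close>
    have xq: "x \<in> agreement q" using x f(3) by (simp add: agreement_iff q a_def)
    have "(+) x ` ?E \<subseteq> agreement q"
      using sub xq F2.subspace_add[OF subspace_agreement[OF lq]] by blast
    moreover have "?E \<inter> (+) x ` ?E = {}" using xE subspace_cancel_right[OF E] by auto
    then have "card (?E \<union> (+) x ` ?E) = 2 * card ?E"
      by (simp add: card_Un_disjoint finite_agreement card_image)
    ultimately show ?thesis
      using card_mono[OF finite_agreement, of "?E \<union> (+) x ` ?E" q] sub by simp
  qed
  ultimately show thesis using that[OF Wq] by blast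
qed

text \<open>Repeated doubling until the map is the base map. This yields reachability and a length
  bound together; the complement of the agreement strictly shrinks because the agreement contains
  0.\<close>

lemma H_path_upper:
  assumes "W_labelling p"
  shows "\<exists>n. (pencil_of p, base_pencil r \<sigma>) \<in> edges (H_graph r \<sigma>) ^^ n \<and>
    card (agreement p) * 2 ^ n \<le> 2 ^ r"
  using assms
proof (induction "2 ^ r - card (agreement p)" arbitrary: p rule: less_induct)
  case less
  show ?case
  proof (cases "\<forall>x\<in>V. p x = base_labelling x")
    case True
    then have "pencil_of p = base_pencil r \<sigma>" unfolding base_pencil_eq by (intro pencil_of_cong) blast
    then show ?thesis using card_agreement_le[of p] by (intro exI[of _ 0]) simp
  next
    case False
    then obtain x where "x \<in> V" "p x \<noteq> base_labelling x" by blast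
    then obtain q where q: "W_labelling q" "(pencil_of p, pencil_of q) \<in> edges (H_graph r \<sigma>)"
      "2 * card (agreement p) \<le> card (agreement q)" by (rule H_descent[OF less.prems])
    have "0 \<in> agreement p"
      using subspace_agreement[OF W_labellingD(1)[OF less.prems]] by (simp add: subspace_iff)
    then have "0 < card (agreement p)" using finite_agreement card_gt_0_iff by blast
    then have "2 ^ r - card (agreement q) < 2 ^ r - card (agreement p)"
      using q(3) card_agreement_le[of q] by linarith
    then obtain n where n: "(pencil_of q, base_pencil r \<sigma>) \<in> edges (H_graph r \<sigma>) ^^ n"
      "card (agreement q) * 2 ^ n \<le> 2 ^ r" using less.hyps q(1) by blast
    have "card (agreement p) * 2 ^ Suc n \<le> card (agreement q) * 2 ^ n"
      using mult_right_mono[OF q(3), of "2 ^ n"] by (simp add: mult_ac)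
    then show ?thesis using n relpow_Suc_I2[OF q(2) n(1)] by (intro exI[of _ "Suc n"]) linarith
  qed
qed

lemma H_path_lower:
  assumes "W_labelling p" "(pencil_of p, base_pencil r \<sigma>) \<in> edges (H_graph r \<sigma>) ^^ n"
  shows "2 ^ r \<le> card (agreement p) * 2 ^ n"
  using assms
proof (induction n arbitrary: p)
  case 0
  then have "pencil_of p = pencil_of base_labelling" by (simp add: base_pencil_eq)
  then have "agreement p = V"
    using pencil_of_eqD[OF W_labellingD(1)[OF "0.prems"(1)] labelling_base]
    by (auto simp: agreement_iff)
  then show ?case by (simp add: card_F2space)
next
  case (Suc n)
  then obtain v where v: "(pencil_of p, v) \<in> edges (H_graph r \<sigma>)"
    "(v, base_pencil r \<sigma>) \<in> edges (H_graph r \<sigma>) ^^ n" by (meson relpow_Suc_D2)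
  then have "v \<in> W_set r \<sigma>" by (simp add: edges_H_iff)
  then obtain q where q: "W_labelling q" "v = pencil_of q" by (rule W_set_labelling)
  have "2 ^ r \<le> card (agreement q) * 2 ^ n" using Suc.IH[OF q(1)] v(2) q(2) by simp
  also have "\<dots> \<le> 2 * card (agreement p) * 2 ^ n"
    using H_edge_card_agreement[OF Suc.prems(1) q(1)] v(1) q(2) by (intro mult_right_mono) simp_all
  finally show ?case by (simp add: mult_ac)
qed

text \<open>Equal kernels make the two fibres over a label cosets of one subspace, so a single
  common point makes them equal. The fixed indices, with 0 added, are therefore the labels that the
  base map takes on the agreement; the summand 1 is the index 0.\<close>

lemma card_F_set:
  assumes p: "W_labelling p"
  shows "(1 + card (F_set r \<sigma> (pencil_of p))) * 2 ^ \<sigma> = card (agreement p)"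
proof -
  let ?b = base_labelling and ?F = "F_set r \<sigma> (pencil_of p)"
  note lp = W_labellingD(1)[OF p] and ker = W_labellingD(3)[OF p]
  have fix_iff: "pencil_of p ! i = base_pencil r \<sigma> ! i \<longleftrightarrow> vec_of_nat i \<in> ?b ` agreement p"
    if i: "i \<in> {1..m1 r \<sigma>}" for i
  proof -
    have "i \<in> {..<2 ^ (r - \<sigma>)}" using i unfolding indices_eq by (rule UnI1)
    then have i': "i < 2 ^ (r - \<sigma>)" "i \<noteq> 0" using i by simp_all
    have "pencil_of p ! i = base_pencil r \<sigma> ! i \<longleftrightarrow>
        {x\<in>V. p x = vec_of_nat i} = {x\<in>V. ?b x = vec_of_nat i}" (is "_ \<longleftrightarrow> ?A = ?B")
      using i' by (simp add: base_pencil_eq nth_pencil_of)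
    also have "\<dots> \<longleftrightarrow> vec_of_nat i \<in> ?b ` agreement p"
    proof
      assume eq: "?A = ?B"
      obtain x where x: "x \<in> V" "?b x = vec_of_nat i"
        using labelling_surj[OF labelling_base vec_of_nat_in_F2space[OF i'(1)]] by blast
      then have "p x = vec_of_nat i" using eq by blast
      then show "vec_of_nat i \<in> ?b ` agreement p"
        using x by (intro image_eqI[of _ _ x]) (simp_all add: agreement_iff)
    next
      assume "vec_of_nat i \<in> ?b ` agreement p"
      then obtain x where "x \<in> agreement p" "?b x = vec_of_nat i" by (metis imageE)
      then have x: "x \<in> V" "p x = vec_of_nat i" "?b x = vec_of_nat i"
        by (simp_all add: agreement_iff)
      have "p y = vec_of_nat i \<longleftrightarrow> ?b y = vec_of_nat i" if y: "y \<in> V" for y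
      proof -
        have "p (x + y) = 0 \<longleftrightarrow> ?b (x + y) = 0" using x(1) y by (intro ker) simp
        then have "vec_of_nat i = p y \<longleftrightarrow> vec_of_nat i = ?b y"
          unfolding labellingD(5)[OF lp x(1) y] labellingD(5)[OF labelling_base x(1) y] x(2,3)
          by (simp only: vec2_add_eq_0_iff)
        then show ?thesis by metis
      qed
      then show "?A = ?B" by blast
    qed
    finally show ?thesis .
  qed
  have E: "F2.subspace (agreement p)" using lp by (rule subspace_agreement)
  have "0 \<in> agreement p" using E by (simp add: subspace_iff)
  then have zero: "vec_of_nat 0 \<in> ?b ` agreement p"
    using labellingD(4)[OF labelling_base] by (intro image_eqI[of _ _ 0]) simp_all
  have "?b ` agreement p = vec_of_nat ` insert 0 ?F"
  proof (intro set_eqI iffI)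
    fix y assume y: "y \<in> ?b ` agreement p"
    then have "y \<in> Q" using labellingD(3)[OF labelling_base] agreement_subset by blast
    then obtain i where i: "i < 2 ^ (r - \<sigma>)" "vec_of_nat i = y" using F2space_vec_of_nat by blast
    then have "i = 0 \<or> i \<in> {1..m1 r \<sigma>}" using indices_eq by blast
    then have "i = 0 \<or> i \<in> ?F" using fix_iff[of i] y i(2) by (auto simp: F_set_def)
    then show "y \<in> vec_of_nat ` insert 0 ?F" using i(2) by blast
  next
    fix y assume "y \<in> vec_of_nat ` insert 0 ?F"
    then obtain i where "y = vec_of_nat i" "i = 0 \<or> i \<in> ?F" by blast
    then show "y \<in> ?b ` agreement p" using zero fix_iff[of i] by (auto simp: F_set_def)
  qed
  then have "card (?b ` agreement p) = card (insert 0 ?F)"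
    using card_image[OF inj_on_subset[OF inj_vec_of_nat subset_UNIV]] by (simp only:)
  also have "\<dots> = 1 + card ?F" by (subst card_insert_disjoint) (auto simp: F_set_def)
  finally have "card (?b ` agreement p) = 1 + card ?F" .
  \<comment> \<open>The agreement contains the whole base kernel, so each of its labels has
    \<open>2 ^ \<sigma>\<close> preimages in it.\<close>
  moreover have "{x\<in>agreement p. ?b x = 0} = {x\<in>V. ?b x = 0}"
    using ker by (auto simp: agreement_iff)
  ultimately show ?thesis
    using card_image_times_kernel[OF E additive_on_subset[OF labellingD(1)[OF labelling_base] agreement_subset] finite_agreement]
      card_kernel[OF labelling_base] by simp
qed

end

theorem theorem5p1:
  fixes r \<sigma> :: nat and w :: pencil
  assumes "r \<ge> 3" and "0 < \<sigma>" and "\<sigma> < r - 1"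
    and "w \<in> W_set r \<sigma>"
  shows "ereal (log 2 (1 + real (card (F_set r \<sigma> w))))
           + ereal_of_enat (graph_dist (H_graph r \<sigma>) w (base_pencil r \<sigma>))
         = ereal (real (r - \<sigma>))"
proof -
  interpret pencil_space r \<sigma> using assms by unfold_locales auto
  obtain p where p: "W_labelling p" "w = pencil_of p" using assms(4) by (rule W_set_labelling)
  define c where "c = 1 + card (F_set r \<sigma> w)"
  have c: "c * 2 ^ \<sigma> = card (agreement p)" using card_F_set[OF p(1)] p(2) by (simp only: c_def)
  obtain n where n: "(w, base_pencil r \<sigma>) \<in> edges (H_graph r \<sigma>) ^^ n"
    "card (agreement p) * 2 ^ n \<le> 2 ^ r" using H_path_upper[OF p(1)] p(2) by blast
  have lower: "2 ^ r \<le> card (agreement p) * 2 ^ m"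
    if "(w, base_pencil r \<sigma>) \<in> edges (H_graph r \<sigma>) ^^ m" for m
    using H_path_lower[OF p(1)] that p(2) by simp
  have "graph_dist (H_graph r \<sigma>) w (base_pencil r \<sigma>) = enat n"
  proof (rule graph_dist_eqI)
    fix m assume "(w, base_pencil r \<sigma>) \<in> edges (H_graph r \<sigma>) ^^ m"
    from lower[OF this] have "card (agreement p) * 2 ^ n \<le> card (agreement p) * 2 ^ m"
      using n(2) by linarith
    moreover have "0 < card (agreement p)" unfolding c[symmetric] by (simp add: c_def)
    ultimately show "n \<le> m" by simp
  qed (rule n(1))
  moreover have "log 2 (1 + real (card (F_set r \<sigma> w))) + real n = real (r - \<sigma>)"
  proof -
    \<comment> \<open>For the walk of length \<open>n\<close> itself the upper and the lower bound
      meet, so the agreement has exactly \<open>2 ^ r\<close> divided by \<open>2 ^ n\<close>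
      elements.\<close>
    have "2 ^ \<sigma> * (c * 2 ^ n) = card (agreement p) * 2 ^ n" unfolding c[symmetric] by (simp only: mult_ac)
    also have "\<dots> = 2 ^ r" using lower[OF n(1)] n(2) by (rule antisym[rotated])
    also have "\<dots> = 2 ^ \<sigma> * 2 ^ (r - \<sigma>)" using assms(3) by (simp flip: power_add)
    finally have "c * 2 ^ n = 2 ^ (r - \<sigma>)" by simp
    then have "real c * 2 ^ n = 2 ^ (r - \<sigma>)" by (metis of_nat_mult of_nat_numeral of_nat_power)
    then have "log 2 (real c * 2 ^ n) = real (r - \<sigma>)" by simp
    then have "log 2 (real c) + real n = real (r - \<sigma>)" by (simp add: log_mult c_def)
    then show ?thesis by (simp add: c_def)
  qed
  ultimately show ?thesis by simp
qed

end
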